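(* Let $\Omega\subset\mathbb{R}^N$ be a bounded domain with smooth (at least Lipschitz) boundary, and let $\omega\in L^1(\Omega)$ satisfy $\int_\Omega \omega\,\mathrm{d}x=1$ and $\omega\ge 0$ a.e. in $\Omega$. Then there exists a nonnegative function $\xi\in C(\overline{\Omega})$ that vanishes on $\partial\Omega$ and satisfies $$\int_\Omega (\log|\xi|)\,\omega\,\mathrm{d}x=0.$$ If, in addition, $$K_\epsilon:=\operatorname*{ess\,sup}_{0\le t\le \epsilon}\int_{\delta^{-1}\{t\}}\omega\,\mathrm{d}\mathcal{H}_{N-1}<\infty$$ for some $\epsilon>0$, then $\xi\in C_0^{0,1}(\overline{\Omega})$ (that is, a nonnegative function $\xi$ that vanishes on $\partial\Omega$ and satisfies $\int_\Omega (\log|\xi|)\,\omega\,\mathrm{d}x=0$ can be taken in $C_0^{0,1}(\overline\Omega)$).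
   Context: $\delta(x):=\min_{y\in\partial\Omega}|x-y|$, $x\in\overline\Omega$, is the distance to the boundary; $\delta^{-1}\{t\}$ is its $t$-level set; $\mathcal{H}_{N-1}$ is the $(N-1)$-dimensional Hausdorff measure. $C_0^{0,1}(\overline\Omega)$ is the space of Lipschitz functions on $\overline\Omega$ vanishing on $\partial\Omega$. Convention: $\log 0=-\infty$ and $0\cdot(-\infty)=0$, i.e. the integral is taken with respect to the measure $\omega\,\mathrm{d}x$. *)

theory Defs
  imports "HOL-Analysis.Analysis" "HOL-Probability.Essential_Supremum"
begin

text \<open>Near every boundary point, \<open>\<Omega>\<close> is the strict epigraph, in some direction \<open>n\<close>, of a
  Lipschitz function \<open>\<gamma>\<close> on the hyperplane orthogonal to \<open>n\<close>; the hyperplane component of \<open>x\<close>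
  is \<open>x - (x \<bullet> n) *\<^sub>R n\<close>. In dimension one the hyperplane is \<open>{0}\<close>.\<close>

definition lipschitz_boundary :: "'a::euclidean_space set \<Rightarrow> bool" where
  "lipschitz_boundary \<Omega> \<longleftrightarrow>
     (\<forall>p\<in>frontier \<Omega>. \<exists>r>0. \<exists>n. \<exists>\<gamma>. \<exists>L. norm n = 1 \<and> L-lipschitz_on {y. y \<bullet> n = 0} \<gamma> \<and>
        \<Omega> \<inter> ball p r = {x \<in> ball p r. \<gamma> (x - (x \<bullet> n) *\<^sub>R n) < x \<bullet> n})"

definition bounded_lipschitz_domain :: "'a::euclidean_space set \<Rightarrow> bool" where
  "bounded_lipschitz_domain \<Omega> \<longleftrightarrow>
     open \<Omega> \<and> connected \<Omega> \<and> \<Omega> \<noteq> {} \<and> bounded \<Omega> \<and> lipschitz_boundary \<Omega>"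

text \<open>The normalisation is the usual one, for which the \<open>N\<close>-dimensional measure agrees with
  Lebesgue measure. Nonempty sets have gauge \<open>1\<close> in dimension \<open>0\<close> because \<open>0 ^ 0 = 1\<close>, so that
  the \<open>0\<close>-dimensional measure is the counting measure; the empty set must be excluded. Covering
  sets are required to be bounded because \<^const>\<open>diameter\<close> is unspecified on unbounded sets.\<close>

definition hausdorff_gauge :: "nat \<Rightarrow> 'a::metric_space set \<Rightarrow> ennreal" where
  "hausdorff_gauge k S =
     (if S = {} then 0 else ennreal (unit_ball_vol (real k) * (diameter S / 2) ^ k))"

definition hausdorff_pre :: "nat \<Rightarrow> real \<Rightarrow> 'a::metric_space set \<Rightarrow> ennreal" where
  "hausdorff_pre k d A =
     (INF C\<in>{C :: nat \<Rightarrow> 'a set. A \<subseteq> (\<Union>i. C i) \<and> (\<forall>i. bounded (C i) \<and> diameter (C i) \<le> d)}.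
        \<Sum>i. hausdorff_gauge k (C i))"

definition hausdorff_outer :: "nat \<Rightarrow> 'a::metric_space set \<Rightarrow> ennreal" where
  "hausdorff_outer k A = (SUP d\<in>{0<..}. hausdorff_pre k d A)"

definition hausdorff_measure :: "nat \<Rightarrow> 'a::metric_space measure" where
  "hausdorff_measure k =
     measure_of UNIV (lambda_system UNIV UNIV (hausdorff_outer k)) (hausdorff_outer k)"

lemma hausdorff_pre_countably_subadditive:
  fixes A :: "nat \<Rightarrow> 'a::metric_space set"
  shows "hausdorff_pre k d (\<Union>i. A i) \<le> (\<Sum>i. hausdorff_pre k d (A i))"
proof (rule ennreal_le_epsilon)
  fix e :: real
  assume e: "0 < e" and fin: "(\<Sum>i. hausdorff_pre k d (A i)) < top"
  have "\<exists>C. A i \<subseteq> (\<Union>j. C j) \<and> (\<forall>j. bounded (C j) \<and> diameter (C j) \<le> d) \<and>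
      (\<Sum>j. hausdorff_gauge k (C j)) \<le> hausdorff_pre k d (A i) + e * (1/2) ^ Suc i" for i
  proof -
    have "hausdorff_pre k d (A i) < top"
      using fin ennreal_suminf_lessD by blast
    then have "hausdorff_pre k d (A i) < hausdorff_pre k d (A i) + ennreal (e * (1/2) ^ Suc i)"
      using e by (auto simp: less_top)
    then show ?thesis
      by (subst (asm) (1) hausdorff_pre_def) (auto simp: INF_less_iff intro: less_imp_le)
  qed
  then obtain C where C: "\<And>i. A i \<subseteq> (\<Union>j. C i j)"
      "\<And>i j. bounded (C i j) \<and> diameter (C i j) \<le> d"
      "\<And>i. (\<Sum>j. hausdorff_gauge k (C i j)) \<le> hausdorff_pre k d (A i) + e * (1/2) ^ Suc i"
    by metis
  define D where "D = (\<lambda>m. case prod_decode m of (i, j) \<Rightarrow> C i j)"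
  have "(\<Union>i. A i) \<subseteq> (\<Union>m. D m)"
  proof
    fix x assume "x \<in> (\<Union>i. A i)"
    then obtain i j where "x \<in> C i j" using C(1) by blast
    then have "x \<in> D (prod_encode (i, j))" by (simp add: D_def)
    then show "x \<in> (\<Union>m. D m)" by blast
  qed
  then have "hausdorff_pre k d (\<Union>i. A i) \<le> (\<Sum>m. hausdorff_gauge k (D m))"
    unfolding hausdorff_pre_def
    by (intro INF_lower) (auto simp: D_def C(2) split: prod.split)
  also have "\<dots> = (\<Sum>i. \<Sum>j. hausdorff_gauge k (C i j))"
    using suminf_ennreal_2dimen[of "\<lambda>i. \<Sum>j. hausdorff_gauge k (C i j)"
        "\<lambda>(i, j). hausdorff_gauge k (C i j)"]
    by (simp add: D_def split_def)
  also have "\<dots> \<le> (\<Sum>i. hausdorff_pre k d (A i) + e * (1/2) ^ Suc i)"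
    by (intro suminf_le C(3)) auto
  also have "\<dots> = (\<Sum>i. hausdorff_pre k d (A i)) + (\<Sum>i. ennreal e * ennreal ((1/2) ^ Suc i))"
    using e by (subst suminf_add[symmetric]) (auto simp del: ennreal_suminf_cmult simp add: ennreal_mult[symmetric])
  also have "(\<Sum>i. ennreal e * ennreal ((1/2) ^ Suc i)) = e"
    unfolding ennreal_suminf_cmult
    by (subst suminf_ennreal_eq[OF zero_le_power power_half_series]) auto
  finally show "hausdorff_pre k d (\<Union>i. A i) \<le> (\<Sum>i. hausdorff_pre k d (A i)) + ennreal e" .
qed

lemma outer_measure_space_hausdorff_outer:
  "outer_measure_space UNIV (hausdorff_outer k :: 'a::metric_space set \<Rightarrow> ennreal)"
  unfolding outer_measure_space_def
proof (intro conjI)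
  have "hausdorff_pre k d ({} :: 'a set) = 0" if "0 < d" for d
  proof -
    have "hausdorff_pre k d ({} :: 'a set) \<le> (\<Sum>i::nat. hausdorff_gauge k ({} :: 'a set))"
      unfolding hausdorff_pre_def using that by (intro INF_lower) auto
    then show ?thesis by (simp add: hausdorff_gauge_def)
  qed
  then show "positive UNIV (hausdorff_outer k :: 'a set \<Rightarrow> ennreal)"
    by (auto simp: positive_def hausdorff_outer_def)
  show "increasing UNIV (hausdorff_outer k :: 'a set \<Rightarrow> ennreal)"
    unfolding increasing_def hausdorff_outer_def hausdorff_pre_def
    by (intro ballI impI SUP_mono') (rule INF_superset_mono, auto)
  show "countably_subadditive UNIV (hausdorff_outer k :: 'a set \<Rightarrow> ennreal)"
    unfolding countably_subadditive_def
  proof (intro allI impI)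
    fix A :: "nat \<Rightarrow> 'a set"
    show "hausdorff_outer k (\<Union>i. A i) \<le> (\<Sum>i. hausdorff_outer k (A i))"
      unfolding hausdorff_outer_def
    proof (rule SUP_least)
      fix d :: real assume d: "d \<in> {0<..}"
      have "hausdorff_pre k d (\<Union>i. A i) \<le> (\<Sum>i. hausdorff_pre k d (A i))"
        by (rule hausdorff_pre_countably_subadditive)
      also have "\<dots> \<le> (\<Sum>i. SUP d\<in>{0<..}. hausdorff_pre k d (A i))"
        using d by (intro suminf_le SUP_upper) auto
      finally show "hausdorff_pre k d (\<Union>i. A i) \<le> \<dots>" .
    qed
  qed
qed

lemma
  fixes A :: "'a::metric_space set"
  shows space_hausdorff_measure: "space (hausdorff_measure k :: 'a measure) = UNIV"
    and sets_hausdorff_measure: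
      "sets (hausdorff_measure k :: 'a measure) = lambda_system UNIV UNIV (hausdorff_outer k)"
    and emeasure_hausdorff_measure:
      "A \<in> lambda_system UNIV UNIV (hausdorff_outer k) \<Longrightarrow>
        emeasure (hausdorff_measure k) A = hausdorff_outer k A"
proof -
  interpret P: sigma_algebra "UNIV :: 'a set" UNIV
    using sigma_algebra_Pow[of "UNIV :: 'a set"] by simp
  have *: "measure_space UNIV (lambda_system UNIV UNIV (hausdorff_outer k))
      (hausdorff_outer k :: 'a set \<Rightarrow> ennreal)"
    by (rule P.caratheodory_lemma[OF outer_measure_space_hausdorff_outer])
  then interpret S: sigma_algebra "UNIV :: 'a set" "lambda_system UNIV UNIV (hausdorff_outer k)"
    by (simp add: measure_space_def)
  show "space (hausdorff_measure k) = (UNIV :: 'a set)"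
    by (simp add: hausdorff_measure_def)
  show "sets (hausdorff_measure k :: 'a measure) = lambda_system UNIV UNIV (hausdorff_outer k)"
    by (simp add: hausdorff_measure_def)
  show "A \<in> lambda_system UNIV UNIV (hausdorff_outer k) \<Longrightarrow>
      emeasure (hausdorff_measure k) A = hausdorff_outer k A"
    unfolding hausdorff_measure_def
    using * by (intro emeasure_measure_of_sigma) (auto simp: measure_space_def)
qed

definition boundary_dist :: "'a::metric_space set \<Rightarrow> 'a \<Rightarrow> real" where
  "boundary_dist \<Omega> x = infdist x (frontier \<Omega>)"

definition boundary_level :: "'a::metric_space set \<Rightarrow> real \<Rightarrow> 'a set" where
  "boundary_level \<Omega> t = {x \<in> closure \<Omega>. boundary_dist \<Omega> x = t}"

text \<open>The essential supremum is taken over the completed measure on \<open>[0, \<epsilon>]\<close>: for a merely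
  Lebesgue measurable \<open>\<omega>\<close> the slice integral need not be Borel measurable in \<open>t\<close>, and
  \<^const>\<open>esssup\<close> is \<open>\<infinity>\<close> on functions that are not measurable. Negative values of \<open>\<omega>\<close>, which occur only on a null
  set, are truncated to \<open>0\<close>.\<close>

definition K_level :: "'a::euclidean_space set \<Rightarrow> ('a \<Rightarrow> real) \<Rightarrow> real \<Rightarrow> ennreal" where
  "K_level \<Omega> \<omega> \<epsilon> = esssup (lebesgue_on {0..\<epsilon>})
     (\<lambda>t. \<integral>\<^sup>+x\<in>boundary_level \<Omega> t. ennreal (\<omega> x) \<partial>hausdorff_measure (DIM('a) - 1))"

text \<open>The library's \<^term>\<open>ln (0::real)\<close> is \<open>0\<close>; here the logarithm of \<open>0\<close> is \<open>-\<infinity>\<close>.\<close>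

definition ext_ln :: "real \<Rightarrow> ereal" where
  "ext_ln x = (if x = 0 then -\<infinity> else ereal (ln x))"

text \<open>Integral of the positive part minus integral of the negative part. If both are infinite the
  value is \<open>\<infinity>\<close>, since \<open>\<infinity> - \<infinity> = \<infinity>\<close> in \<^typ>\<open>ereal\<close>; in particular a finite value is
  attained only when both parts are finite.\<close>

definition ext_integral :: "'a measure \<Rightarrow> ('a \<Rightarrow> ereal) \<Rightarrow> ereal" where
  "ext_integral M f =
     enn2ereal (\<integral>\<^sup>+x. e2ennreal (f x) \<partial>M) - enn2ereal (\<integral>\<^sup>+x. e2ennreal (- f x) \<partial>M)"

text \<open>Integration against the measure \<open>\<omega> dx\<close> implements \<open>0 \<cdot> (-\<infinity>) = 0\<close>.\<close>

definition log_integral :: "'a::euclidean_space set \<Rightarrow> ('a \<Rightarrow> real) \<Rightarrow> ('a \<Rightarrow> real) \<Rightarrow> ereal" where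
  "log_integral \<Omega> \<omega> \<xi> =
     ext_integral (density (lebesgue_on \<Omega>) (\<lambda>x. ennreal (\<omega> x))) (\<lambda>x. ext_ln \<bar>\<xi> x\<bar>)"

definition lipschitz_zero :: "'a::metric_space set \<Rightarrow> ('a \<Rightarrow> real) set" where
  "lipschitz_zero \<Omega> = {\<xi>. (\<exists>L. L-lipschitz_on (closure \<Omega>) \<xi>) \<and> (\<forall>x\<in>frontier \<Omega>. \<xi> x = 0)}"

end

theory Submission
  imports Defs
begin

text \<open>Write \<open>\<delta>\<close> for the distance to \<open>\<partial>\<Omega>\<close> and \<open>\<mu> = \<omega> dx\<close>, a probability measure on \<open>\<Omega>\<close>. If a
  nonnegative bounded function \<open>\<psi>\<close> has \<open>\<integral> log \<psi> d\<mu>\<close> finite, then \<open>\<xi> = c \<psi>\<close> with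
  \<open>c = exp (- \<integral> log \<psi> d\<mu>)\<close> has logarithmic integral \<open>0\<close>. Since \<open>- log y\<close> is at most the number of
  \<open>k\<close> with \<open>y < 2\<^sup>-\<^sup>k\<close>, finiteness follows from \<open>\<mu> {\<psi> < 2\<^sup>-\<^sup>k} = O(2\<^sup>-\<^sup>k)\<close>
  (\<open>exists_scaling_log_integral_zero\<close>), so both parts of the theorem ask for a \<open>\<psi>\<close> that vanishes on
  the boundary and whose small sublevel sets have little mass.

  For the first part, \<open>\<mu> {\<delta> < t} \<rightarrow> 0\<close> as \<open>t \<rightarrow> 0\<close>, because \<open>\<delta> > 0\<close> in \<open>\<Omega>\<close>. Choose \<open>T k > 0\<close> with
  \<open>\<mu> {\<delta> < T k} < 2\<^sup>-\<^sup>k\<close> and put \<open>\<psi> = h \<circ> \<delta>\<close>, where \<open>h\<close> is continuous, vanishes at \<open>0\<close> and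
  satisfies \<open>h \<ge> 2\<^sup>-\<^sup>k\<close> on \<open>[T k, \<infinity>)\<close> (\<open>exists_profile_above_dyadic\<close>).

  For the second part \<open>\<psi> = \<delta>\<close> works, which is Lipschitz, once \<open>\<mu> {\<delta> < r} = O(r)\<close> is known
  (\<open>boundary_layer_mass_le\<close>). With the coarea formula and \<open>|\<nabla>\<delta>| = 1\<close> this is integration of the
  bound on the slice integrals over \<open>0 < t < r\<close>. Only an inequality up to a constant is needed, and
  the Lipschitz boundary yields it without differentiating \<open>\<delta>\<close>. Near a boundary point the domain is
  invariant under a cone of translations around a direction \<open>n\<close>, hence \<open>\<delta>\<close> grows at a rate at least
  \<open>c > 0\<close> along \<open>n\<close> (\<open>boundary_dist_increasing_locally\<close>). For a compact set \<open>A\<close> in such a patch, let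
  \<open>A\<^sub>t = A \<inter> {\<delta> = t}\<close> and sweep \<open>A\<^sub>t\<close> along the segment from \<open>0\<close> to \<open>n\<close>. On the one hand, Fubini's
  theorem on lines parallel to \<open>n\<close> gives \<open>c |A| \<le> \<integral> |A\<^sub>t + [0,1] n| dt\<close>
  (\<open>coarea_sweep_inequality\<close>); on the other hand a swept set has volume at most a constant times the
  \<open>(N-1)\<close>-dimensional Hausdorff measure of its base (\<open>emeasure_sweep_le_hausdorff_outer\<close>). Together
  they bound \<open>|A|\<close> by the integral of the measures of its slices; approximating \<open>\<omega>\<close> from below by
  step functions with compact steps, and covering the compact boundary by finitely many patches,
  gives the estimate.\<close>

section \<open>Finite logarithmic integrals and scaling\<close>

lemma ext_integral_ereal:
  assumes u: "integrable M u" and f: "AE x in M. f x = ereal (u x)"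
  shows "ext_integral M f = ereal (\<integral>x. u x \<partial>M)"
proof -
  have "(\<integral>\<^sup>+x. e2ennreal (f x) \<partial>M) = (\<integral>\<^sup>+x. ennreal (u x) \<partial>M)"
    using f by (intro nn_integral_cong_AE) (auto elim!: eventually_mono)
  moreover have "(\<integral>\<^sup>+x. e2ennreal (- f x) \<partial>M) = (\<integral>\<^sup>+x. ennreal (- u x) \<partial>M)"
    using f by (intro nn_integral_cong_AE) (auto elim!: eventually_mono)
  moreover have "(\<integral>\<^sup>+x. ennreal (u x) \<partial>M) \<noteq> \<infinity>" "(\<integral>\<^sup>+x. ennreal (- u x) \<partial>M) \<noteq> \<infinity>"
    using u by (auto simp: real_integrable_def)
  ultimately show ?thesis
    unfolding ext_integral_def real_lebesgue_integral_def[OF u]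
    by (cases "\<integral>\<^sup>+x. ennreal (u x) \<partial>M"; cases "\<integral>\<^sup>+x. ennreal (- u x) \<partial>M")
       (auto simp: enn2real_def)
qed

text \<open>The series counts the \<open>k\<close> with \<open>y < 2\<^sup>-\<^sup>k\<close>. Integrating it turns a bound on the distribution of
  a function near \<open>0\<close> into a bound on the integral of its logarithm.\<close>

lemma neg_ln_le_card_dyadic:
  fixes y :: real
  assumes "0 < y"
  shows "ennreal (- ln y) \<le> (\<Sum>k. indicator {..<(1 / 2) ^ k} y)"
proof -
  have ex: "\<exists>k. (1 / 2) ^ k \<le> y"
    using real_arch_pow_inv[OF assms, of "1/2"] by (auto intro: less_imp_le)
  define K where "K = (LEAST k. (1 / 2) ^ k \<le> y)"
  have K: "(1 / 2) ^ K \<le> y" unfolding K_def using ex by (rule LeastI_ex)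
  have less: "y < (1 / 2) ^ k" if "k < K" for k
    using not_less_Least[of k "\<lambda>k. (1 / 2) ^ k \<le> y"] that by (simp add: K_def)
  have "- ln y \<le> - ln ((1 / 2) ^ K)"
    using K assms by simp
  also have "\<dots> = K * ln 2"
    by (simp add: ln_realpow ln_div)
  also have "\<dots> \<le> real K * 1"
    using ln_2_less_1 by (intro mult_left_mono) auto
  finally have "ennreal (- ln y) \<le> of_nat K"
    by (simp add: ennreal_leI flip: ennreal_of_nat_eq_real_of_nat)
  also have "\<dots> = (\<Sum>k<K. indicator {..<(1 / 2) ^ k} y)"
    using less by (simp add: indicator_def)
  also have "\<dots> \<le> (\<Sum>k. indicator {..<(1 / 2) ^ k} y)"
    by (intro sum_le_suminf) auto
  finally show ?thesis .
qed

text \<open>Integrating the count of dyadic levels bounds \<open>\<integral> (log \<psi>)\<^sup>- dM\<close> by \<open>\<Sum>\<^sub>k M {\<psi> < 2\<^sup>-\<^sup>k}\<close>, and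
  the upper bound on \<open>\<psi>\<close> controls the positive part; scaling then shifts the integral of the
  logarithm by a constant.\<close>

lemma exists_scaling_log_integral_zero:
  assumes total: "emeasure M (space M) = 1" and psi[measurable]: "\<psi> \<in> borel_measurable M"
    and nonneg: "\<And>x. x \<in> space M \<Longrightarrow> 0 \<le> \<psi> x" and bound: "\<And>x. x \<in> space M \<Longrightarrow> \<psi> x \<le> b"
    and small_le: "\<And>k. emeasure M {x \<in> space M. \<psi> x < (1 / 2) ^ k} \<le> ennreal (C * (1 / 2) ^ k)"
  shows "\<exists>c>0. ext_integral M (\<lambda>x. ext_ln \<bar>c * \<psi> x\<bar>) = 0"
proof -
  interpret finite_measure M by standard (simp add: total)
  have small: "(\<Sum>k. emeasure M {x \<in> space M. \<psi> x < (1 / 2) ^ k}) < \<infinity>"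
  proof -
    have "(\<Sum>k. emeasure M {x \<in> space M. \<psi> x < (1 / 2) ^ k}) \<le> (\<Sum>k. ennreal (\<bar>C\<bar> * (1 / 2) ^ k))"
      by (intro suminf_le order_trans[OF small_le] ennreal_leI mult_right_mono) auto
    also have "\<dots> = ennreal (\<Sum>k. \<bar>C\<bar> * (1 / 2) ^ k)"
      by (intro suminf_ennreal2 summable_mult summable_geometric) auto
    finally show ?thesis by (simp add: order_le_less_trans)
  qed
  have sum_eq: "(\<integral>\<^sup>+x. (\<Sum>k. indicator {..<(1 / 2) ^ k} (\<psi> x)) \<partial>M)
      = (\<Sum>k. emeasure M {x \<in> space M. \<psi> x < (1 / 2) ^ k})"
  proof (subst nn_integral_suminf)
    fix k
    show "(\<lambda>x. indicator {..<(1 / 2) ^ k} (\<psi> x)) \<in> borel_measurable M" by measurable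
  next
    have "(\<integral>\<^sup>+x. indicator {..<(1 / 2) ^ k} (\<psi> x) \<partial>M) = emeasure M {x \<in> space M. \<psi> x < (1 / 2) ^ k}" for k
    proof -
      have "(\<integral>\<^sup>+x. indicator {..<(1 / 2) ^ k} (\<psi> x) \<partial>M)
          = (\<integral>\<^sup>+x. indicator {x \<in> space M. \<psi> x < (1 / 2) ^ k} x \<partial>M)"
        by (intro nn_integral_cong) (auto simp: indicator_def)
      then show ?thesis by simp
    qed
    then show "(\<Sum>k. \<integral>\<^sup>+x. indicator {..<(1 / 2) ^ k} (\<psi> x) \<partial>M)
      = (\<Sum>k. emeasure M {x \<in> space M. \<psi> x < (1 / 2) ^ k})" by simp
  qed
  have pos: "AE x in M. 0 < \<psi> x"
  proof -
    have "AE x in M. (\<Sum>k. indicator {..<(1 / 2) ^ k} (\<psi> x) :: ennreal) \<noteq> \<infinity>"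
    proof (rule nn_integral_noteq_infinite)
      show "(\<lambda>x. \<Sum>k. indicator {..<(1 / 2) ^ k} (\<psi> x) :: ennreal) \<in> borel_measurable M" by measurable
      show "(\<integral>\<^sup>+x. (\<Sum>k. indicator {..<(1 / 2) ^ k} (\<psi> x)) \<partial>M) \<noteq> \<infinity>"
        using small by (simp add: sum_eq)
    qed
    then show ?thesis
    proof (eventually_elim)
      case (elim x)
      show ?case
      proof (rule ccontr)
        assume "\<not> 0 < \<psi> x"
        then have "\<psi> x < (1 / 2) ^ k" for k by (meson not_less order_le_less_trans zero_less_power half_gt_zero zero_less_one)
        then have "(\<Sum>k. indicator {..<(1 / 2) ^ k} (\<psi> x) :: ennreal) = (\<Sum>k. 1)" by simp
        also have "\<dots> = \<infinity>"
        proof -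
          have "of_nat m \<le> (\<Sum>k::nat. 1 :: ennreal)" for m
            using sum_le_suminf[of "\<lambda>_. 1 :: ennreal" "{..<m}"] by simp
          then show ?thesis
            using ennreal_Ex_less_of_nat[of "\<Sum>k::nat. 1 :: ennreal"] by (metis infinity_ennreal_def leD less_top)
        qed
        finally show False using elim by simp
      qed
    qed
  qed
  have int: "integrable M (\<lambda>x. ln (\<psi> x))"
  proof -
    have "AE x in M. ennreal (ln (\<psi> x)) \<le> ennreal b"
      using pos AE_space
    proof eventually_elim
      case (elim x)
      then have "ln (\<psi> x) \<le> b"
        using ln_less_self[of "\<psi> x"] bound[of x] by linarith
      then show ?case by (rule ennreal_leI)
    qed
    then have "(\<integral>\<^sup>+x. ennreal (ln (\<psi> x)) \<partial>M) \<le> (\<integral>\<^sup>+x. ennreal b \<partial>M)"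
      by (rule nn_integral_mono_AE)
    then have 1: "(\<integral>\<^sup>+x. ennreal (ln (\<psi> x)) \<partial>M) < \<infinity>"
      by (simp add: total order_le_less_trans)
    have "(\<integral>\<^sup>+x. ennreal (- ln (\<psi> x)) \<partial>M) \<le> (\<integral>\<^sup>+x. (\<Sum>k. indicator {..<(1 / 2) ^ k} (\<psi> x)) \<partial>M)"
      using pos by (intro nn_integral_mono_AE) (auto elim!: eventually_mono intro: neg_ln_le_card_dyadic)
    then have 2: "(\<integral>\<^sup>+x. ennreal (- ln (\<psi> x)) \<partial>M) < \<infinity>"
      using small by (simp add: sum_eq order_le_less_trans)
    show ?thesis
      using 1 2 by (auto simp: real_integrable_def)
  qed
  define c where "c = exp (- (\<integral>x. ln (\<psi> x) \<partial>M))"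
  have "ext_integral M (\<lambda>x. ext_ln \<bar>c * \<psi> x\<bar>) = ereal (\<integral>x. ln c + ln (\<psi> x) \<partial>M)"
  proof (rule ext_integral_ereal)
    show "integrable M (\<lambda>x. ln c + ln (\<psi> x))" using int by simp
    show "AE x in M. ext_ln \<bar>c * \<psi> x\<bar> = ereal (ln c + ln (\<psi> x))"
      using pos by eventually_elim (simp add: ext_ln_def c_def ln_mult)
  qed
  also have "(\<integral>x. ln c + ln (\<psi> x) \<partial>M) = 0"
    using int by (simp add: c_def measure_def total)
  finally show ?thesis by (intro exI[of _ c]) (simp add: c_def zero_ereal_def)
qed

section \<open>Closed sets are Hausdorff measurable\<close>

text \<open>Caratheodory's criterion for metric outer measures. Given a test set \<open>T\<close>, the part of \<open>T\<close> at
  distance at least \<open>1/(n+1)\<close> from \<open>F\<close> is positively separated from \<open>F\<close>, and what is missing from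
  \<open>T - F\<close> is a union of rings \<open>R k\<close> around \<open>F\<close>. The measures of the rings have a finite sum, since
  rings whose indices differ by at least two are positively separated.\<close>

lemma lambda_system_closed_if_metric_outer:
  fixes f :: "'a::metric_space set \<Rightarrow> ennreal"
  assumes oms: "outer_measure_space UNIV f"
    and sep: "\<And>A B d. 0 < d \<Longrightarrow> (\<And>a b. a \<in> A \<Longrightarrow> b \<in> B \<Longrightarrow> d \<le> dist a b) \<Longrightarrow>
                 f A + f B \<le> f (A \<union> B)"
    and F: "closed F"
  shows "F \<in> lambda_system UNIV UNIV f"
proof -
  have mono: "A \<subseteq> B \<Longrightarrow> f A \<le> f B" for A B
    using oms by (auto simp: outer_measure_space_def increasing_def)
  have f0: "f {} = 0"
    using oms by (auto simp: outer_measure_space_def positive_def)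
  have csub: "f (\<Union>i. A i) \<le> (\<Sum>i. f (A i))" for A :: "nat \<Rightarrow> 'a set"
  proof -
    have "f (\<Union>i. disjointed A i) \<le> (\<Sum>i. f (disjointed A i))"
      using oms disjoint_family_disjointed[of A]
      by (simp add: outer_measure_space_def countably_subadditive_def)
    also have "\<dots> \<le> (\<Sum>i. f (A i))"
      by (intro suminf_le mono disjointed_subset) auto
    finally show ?thesis by (simp add: UN_disjointed_eq)
  qed
  have sub: "f (A \<union> B) \<le> f A + f B" for A B
  proof -
    have "(\<Union>i::nat. (if i = 0 then A else if i = 1 then B else {})) = A \<union> B"
      by (auto split: if_splits)
    then have "f (A \<union> B) \<le> (\<Sum>i::nat. f (if i = 0 then A else if i = 1 then B else {}))"
      using csub[of "\<lambda>i. if i = 0 then A else if i = 1 then B else {}"] by simp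
    also have "\<dots> = (\<Sum>i\<in>{0, 1::nat}. f (if i = 0 then A else if i = 1 then B else {}))"
      by (rule suminf_finite) (auto simp: f0)
    finally show ?thesis by simp
  qed
  have main: "f (F \<inter> T) + f (- F \<inter> T) \<le> f T" for T
  proof (cases "F = {} \<or> f T = top")
    case False
    then have Fne: "F \<noteq> {}" and fin: "f T < top" by (auto simp: less_top)
    define g where "g x = infdist x F" for x
    define c where "c k = 1 / real (Suc k)" for k
    define R where "R k = {x \<in> T. c (Suc k) \<le> g x \<and> g x < c k}" for k
    define U where "U n = {x \<in> T. c n \<le> g x}" for n
    have c_less: "c k < c j" if "j < k" for j k
      using that by (simp add: c_def frac_less2)
    have c_pos: "0 < c k" for k by (simp add: c_def)
    have g_dist: "g x - g y \<le> dist x y" for x y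
      using infdist_triangle[of x F y] by (simp add: g_def)
    have U_bound: "f (F \<inter> T) + f (U n) \<le> f T" for n
    proof -
      have "f (F \<inter> T) + f (U n) \<le> f (F \<inter> T \<union> U n)"
      proof (rule sep[OF c_pos[of n]])
        fix a b assume "a \<in> F \<inter> T" "b \<in> U n"
        then show "c n \<le> dist a b"
          using g_dist[of b a] by (simp add: g_def U_def dist_commute)
      qed
      also have "\<dots> \<le> f T" by (rule mono) (auto simp: U_def)
      finally show ?thesis .
    qed
    \<comment> \<open>Rings of the same parity are positively separated.\<close>
    have parity: "(\<Sum>k<m. f (R (2 * k + i))) \<le> f T" for m i
    proof -
      define V where "V m = (\<Union>k<m. R (2 * k + i))" for m
      have "(\<Sum>k<m. f (R (2 * k + i))) \<le> f (V m)" for m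
      proof (induction m)
        case (Suc m)
        have "(\<Sum>k<Suc m. f (R (2 * k + i))) = (\<Sum>k<m. f (R (2 * k + i))) + f (R (2 * m + i))"
          by simp
        also have "\<dots> \<le> f (V m) + f (R (2 * m + i))"
          by (intro add_right_mono Suc.IH)
        also have "\<dots> \<le> f (V m \<union> R (2 * m + i))"
        proof (cases m)
          case 0
          then show ?thesis by (simp add: V_def f0)
        next
          case (Suc l)
          show ?thesis
          proof (rule sep)
            show "0 < c (2 * l + i + 1) - c (2 * m + i)"
              using Suc by (simp add: c_less)
            fix a b assume a: "a \<in> V m" and b: "b \<in> R (2 * m + i)"
            from a obtain k where k: "k \<le> l" "a \<in> R (2 * k + i)"
              by (auto simp: V_def Suc less_Suc_eq_le)
            have "c (2 * l + i + 1) \<le> c (2 * k + i + 1)"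
              using k(1) by (simp add: c_def frac_le)
            also have "\<dots> \<le> g a" using k(2) by (simp add: R_def)
            finally show "c (2 * l + i + 1) - c (2 * m + i) \<le> dist a b"
              using b g_dist[of a b] by (simp add: R_def)
          qed
        qed
        also have "V m \<union> R (2 * m + i) = V (Suc m)"
          by (auto simp: V_def less_Suc_eq)
        finally show ?case .
      qed (simp add: V_def)
      also have "f (V m) \<le> f T" by (rule mono) (auto simp: V_def R_def)
      finally show ?thesis .
    qed
    have ring_sum: "(\<Sum>k. f (R k)) < top"
    proof -
      have "(\<Sum>k<m. f (R k)) \<le> f T + f T" for m
      proof -
        have "(\<Sum>k<m. f (R k)) \<le> (\<Sum>k<2 * m. f (R k))"
          by (rule sum_mono2) auto
        also have "\<dots> = (\<Sum>k<m. f (R (2 * k + 0))) + (\<Sum>k<m. f (R (2 * k + 1)))"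
          by (induction m) (auto simp: algebra_simps)
        also have "\<dots> \<le> f T + f T" by (intro add_mono parity)
        finally show ?thesis .
      qed
      then have "(\<Sum>k. f (R k)) \<le> f T + f T" by (intro suminf_le_const) auto
      then show ?thesis using fin by (simp add: order_le_less_trans)
    qed
    have c_lim: "c \<longlonglongrightarrow> 0" unfolding c_def using LIMSEQ_Suc[OF lim_1_over_n] by simp
    have tail: "f (- F \<inter> T) \<le> f (U n) + (\<Sum>k. f (R (k + n)))" for n
    proof -
      have "- F \<inter> T \<subseteq> U n \<union> (\<Union>k. R (k + n))"
      proof
        fix x assume x: "x \<in> - F \<inter> T"
        then have "0 < g x"
          using in_closed_iff_infdist_zero[OF F Fne, of x] infdist_nonneg[of x F]
          by (auto simp: g_def less_le)
        then have "\<exists>k. c k \<le> g x"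
          using order_tendstoD(2)[OF c_lim, of "g x"] by (auto simp: eventually_sequentially intro: less_imp_le)
        then obtain k where k: "c k \<le> g x" "\<And>j. j < k \<Longrightarrow> g x < c j"
          using exists_least_iff[of "\<lambda>k. c k \<le> g x"] by (auto simp: not_le)
        show "x \<in> U n \<union> (\<Union>k. R (k + n))"
        proof (cases "k \<le> n")
          case True
          then have "c n \<le> c k" by (simp add: c_def frac_le)
          then show ?thesis using k(1) x by (simp add: U_def)
        next
          case False
          then have "x \<in> R ((k - Suc n) + n)"
            using k x by (auto simp: R_def Suc_diff_Suc)
          then show ?thesis by blast
        qed
      qed
      then have "f (- F \<inter> T) \<le> f (U n \<union> (\<Union>k. R (k + n)))" by (rule mono)
      also have "\<dots> \<le> f (U n) + f (\<Union>k. R (k + n))" by (rule sub)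
      also have "\<dots> \<le> f (U n) + (\<Sum>k. f (R (k + n)))" by (intro add_left_mono csub)
      finally show ?thesis .
    qed
    \<comment> \<open>Adding the first \<open>n\<close> rings on both sides makes the right-hand side independent of \<open>n\<close>, and
      the finite sum can be cancelled in the limit.\<close>
    have "f (F \<inter> T) + f (- F \<inter> T) + (\<Sum>k<n. f (R k)) \<le> f T + (\<Sum>k. f (R k))" for n
    proof -
      have "f (F \<inter> T) + f (- F \<inter> T) + (\<Sum>k<n. f (R k))
          \<le> f (F \<inter> T) + (f (U n) + (\<Sum>k. f (R (k + n)))) + (\<Sum>k<n. f (R k))"
        by (intro add_mono tail order_refl)
      also have "\<dots> = (f (F \<inter> T) + f (U n)) + ((\<Sum>k. f (R (k + n))) + (\<Sum>k<n. f (R k)))"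
        by (simp add: add_ac)
      also have "(\<Sum>k. f (R (k + n))) + (\<Sum>k<n. f (R k)) = (\<Sum>k. f (R k))"
        by (rule suminf_offset[symmetric]) simp
      also have "f (F \<inter> T) + f (U n) + \<dots> \<le> f T + \<dots>"
        by (intro add_right_mono U_bound)
      finally show ?thesis .
    qed
    then have "f (F \<inter> T) + f (- F \<inter> T) + (\<Sum>k. f (R k)) \<le> f T + (\<Sum>k. f (R k))"
      by (intro LIMSEQ_le_const2[OF tendsto_add[OF tendsto_const summable_LIMSEQ]]) auto
    then show ?thesis
      using ring_sum by (auto simp: ennreal_add_left_cancel_le add.commute[of _ "\<Sum>k. f (R k)"])
  qed (auto simp: f0 intro: mono)
  have "f (F \<inter> T) + f ((UNIV - F) \<inter> T) = f T" for T
  proof (rule antisym)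
    show "f (F \<inter> T) + f ((UNIV - F) \<inter> T) \<le> f T"
      using main[of T] by (simp add: Compl_eq_Diff_UNIV)
    have "T = F \<inter> T \<union> (UNIV - F) \<inter> T" by auto
    then show "f T \<le> f (F \<inter> T) + f ((UNIV - F) \<inter> T)"
      using sub[of "F \<inter> T" "(UNIV - F) \<inter> T"] by simp
  qed
  then show ?thesis by (simp add: lambda_system_def)
qed

lemma closed_in_sets_hausdorff_measure:
  fixes F :: "'a::metric_space set"
  assumes "closed F"
  shows "F \<in> sets (hausdorff_measure k)"
  unfolding sets_hausdorff_measure
proof (rule lambda_system_closed_if_metric_outer[OF outer_measure_space_hausdorff_outer _ assms])
  fix A B :: "'a set" and r :: real
  assume r: "0 < r" and sep: "\<And>a b. a \<in> A \<Longrightarrow> b \<in> B \<Longrightarrow> r \<le> dist a b"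
  have pre_mono: "hausdorff_pre k d' S \<le> hausdorff_pre k d S" if "d \<le> d'" for d d' and S :: "'a set"
    unfolding hausdorff_pre_def using that
    by (intro INF_superset_mono) (auto intro: order_trans)
  \<comment> \<open>A covering set of diameter less than \<open>r\<close> meets at most one of the two sets.\<close>
  have pre_sep: "hausdorff_pre k d A + hausdorff_pre k d B \<le> hausdorff_pre k d (A \<union> B)"
    if d: "0 < d" "d < r" for d
    unfolding hausdorff_pre_def[of k d "A \<union> B"]
  proof (rule INF_greatest)
    fix C :: "nat \<Rightarrow> 'a set"
    assume "C \<in> {C. A \<union> B \<subseteq> (\<Union>i. C i) \<and> (\<forall>i. bounded (C i) \<and> diameter (C i) \<le> d)}"
    then have C: "A \<union> B \<subseteq> (\<Union>i. C i)" "\<And>i. bounded (C i)" "\<And>i. diameter (C i) \<le> d" by auto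
    define CA where "CA i = (if C i \<inter> A = {} then {} else C i)" for i
    define CB where "CB i = (if C i \<inter> B = {} then {} else C i)" for i
    have "hausdorff_pre k d A \<le> (\<Sum>i. hausdorff_gauge k (CA i))"
      unfolding hausdorff_pre_def using C d by (intro INF_lower) (fastforce simp: CA_def)
    moreover have "hausdorff_pre k d B \<le> (\<Sum>i. hausdorff_gauge k (CB i))"
      unfolding hausdorff_pre_def using C d by (intro INF_lower) (fastforce simp: CB_def)
    ultimately have "hausdorff_pre k d A + hausdorff_pre k d B
        \<le> (\<Sum>i. hausdorff_gauge k (CA i)) + (\<Sum>i. hausdorff_gauge k (CB i))"
      by (rule add_mono)
    also have "\<dots> = (\<Sum>i. hausdorff_gauge k (CA i) + hausdorff_gauge k (CB i))"
      by (rule suminf_add) auto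
    also have "\<dots> \<le> (\<Sum>i. hausdorff_gauge k (C i))"
    proof (intro suminf_le)
      fix i
      have "C i \<inter> A = {} \<or> C i \<inter> B = {}"
      proof (rule ccontr)
        assume "\<not> ?thesis"
        then obtain a b where "a \<in> C i" "a \<in> A" "b \<in> C i" "b \<in> B" by blast
        then show False
          using sep[of a b] diameter_bounded_bound[OF C(2), of a i b] C(3)[of i] d by simp
      qed
      then show "hausdorff_gauge k (CA i) + hausdorff_gauge k (CB i) \<le> hausdorff_gauge k (C i)"
        by (auto simp: CA_def CB_def hausdorff_gauge_def)
    qed auto
    finally show "hausdorff_pre k d A + hausdorff_pre k d B \<le> (\<Sum>i. hausdorff_gauge k (C i))" .
  qed
  have le_pre: "hausdorff_pre k d S \<le> hausdorff_outer k S" if "0 < d" for d and S :: "'a set"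
    unfolding hausdorff_outer_def using that by (intro SUP_upper) auto
  have "hausdorff_pre k d A + hausdorff_pre k d' B \<le> hausdorff_outer k (A \<union> B)"
    if "0 < d" "0 < d'" for d d'
  proof -
    define m where "m = min (min d d') (r / 2)"
    have "hausdorff_pre k d A + hausdorff_pre k d' B \<le> hausdorff_pre k m A + hausdorff_pre k m B"
      by (intro add_mono pre_mono) (auto simp: m_def)
    also have "\<dots> \<le> hausdorff_pre k m (A \<union> B)"
      using that r by (intro pre_sep) (auto simp: m_def)
    also have "\<dots> \<le> hausdorff_outer k (A \<union> B)"
      using that r by (intro le_pre) (auto simp: m_def)
    finally show ?thesis .
  qed
  note pre_add = this
  have "hausdorff_outer k A + hausdorff_outer k B
      = (SUP d\<in>{0<..}. SUP d'\<in>{0<..}. hausdorff_pre k d A + hausdorff_pre k d' B)"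
    unfolding hausdorff_outer_def
    by (subst ennreal_SUP_add_left[symmetric], simp)
       (intro SUP_cong refl ennreal_SUP_add_right, simp)
  also have "\<dots> \<le> hausdorff_outer k (A \<union> B)"
    using pre_add by (intro SUP_least) auto
  finally show "hausdorff_outer k A + hausdorff_outer k B \<le> hausdorff_outer k (A \<union> B)" .
qed

section \<open>Hausdorff measure controls the volume of swept sets\<close>

definition sweep :: "'a::euclidean_space \<Rightarrow> 'a set \<Rightarrow> 'a set" where
  "sweep n S = (\<lambda>(x, s). x + s *\<^sub>R n) ` (S \<times> {0..1})"

lemma compact_sweep: "compact S \<Longrightarrow> compact (sweep n S)"
  unfolding sweep_def
  by (intro compact_continuous_image compact_Times) (auto simp: split_def intro!: continuous_intros)

text \<open>A set of diameter at most \<open>\<eta>\<close> swept along a unit vector is covered by about \<open>1/\<eta>\<close> balls of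
  radius \<open>2\<eta>\<close>, with total volume of order \<open>\<eta>\<^sup>N\<^sup>-\<^sup>1\<close>. Taking \<open>\<eta>\<close> slightly larger than the diameter and
  passing to the limit includes sets of diameter \<open>0\<close>, where the bound is \<open>0\<close> for \<open>N > 1\<close> and a
  positive constant for \<open>N = 1\<close>, in agreement with the Hausdorff gauge.\<close>

lemma emeasure_sweep_le:
  fixes S :: "'a::euclidean_space set"
  assumes S: "compact S" "S \<noteq> {}" and d: "diameter S < 1" and n: "norm n = 1"
  shows "emeasure lborel (sweep n S)
    \<le> ennreal (3 * 2 ^ DIM('a) * unit_ball_vol (real DIM('a)) * diameter S ^ (DIM('a) - 1))"
proof -
  define C where "C = 3 * 2 ^ DIM('a) * unit_ball_vol (real DIM('a))"
  obtain z where z: "z \<in> S" using S(2) by blast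
  have d0: "0 \<le> diameter S" by (rule diameter_ge_0[OF compact_imp_bounded[OF S(1)]])
  have eta: "emeasure lborel (sweep n S) \<le> ennreal (C * \<eta> ^ (DIM('a) - 1))"
    if e: "diameter S < \<eta>" "\<eta> < 1" for \<eta>
  proof -
    have e0: "0 < \<eta>" using d0 e by linarith
    define m where "m = nat \<lceil>1 / \<eta>\<rceil>"
    have m1: "1 / \<eta> \<le> m" unfolding m_def by linarith
    have m2: "real m \<le> 1 / \<eta> + 1" 
      unfolding m_def using e0 of_int_ceiling_le_add_one[of "1 / \<eta>"] by simp
    have m0: "0 < real m" using m1 e0 by (meson divide_pos_pos less_le_trans zero_less_one)
    have minv: "1 / m \<le> \<eta>" using m1 m0 e0 by (simp add: field_simps)
    define Z where "Z j = cball (z + (real j / m) *\<^sub>R n) (2 * \<eta>)" for j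
    have sub: "sweep n S \<subseteq> (\<Union>j\<le>m. Z j)"
    proof
      fix y assume "y \<in> sweep n S"
      then obtain x s where y: "y = x + s *\<^sub>R n" "x \<in> S" "0 \<le> s" "s \<le> 1"
        by (auto simp: sweep_def)
      define j where "j = nat \<lfloor>s * m\<rfloor>"
      have "s * m \<le> m" using y m0 by (simp add: mult_left_le_one_le)
      moreover have "0 \<le> s * m" using y m0 by simp
      ultimately have j: "j \<le> m" "real j \<le> s * m" "s * m \<le> real j + 1"
        unfolding j_def by (simp_all add: nat_le_iff floor_le_iff)
      have "s - j / m = (s * m - j) / m" using m0 by (simp add: field_simps)
      then have "\<bar>s - j / m\<bar> = \<bar>s * m - j\<bar> / m" using m0 by simp
      also have "\<bar>s * m - j\<bar> \<le> 1" using j by linarith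
      finally have "\<bar>s - j / m\<bar> \<le> 1 / m" using m0 by (simp add: divide_right_mono)
      then have "\<bar>s - j / m\<bar> \<le> \<eta>" using minv by linarith
      have "dist (z + (real j / m) *\<^sub>R n) y \<le> dist z x + norm ((real j / m - s) *\<^sub>R n)"
        unfolding y dist_norm scaleR_diff_left
        by (rule order_trans[OF _ norm_triangle_ineq]) (simp add: algebra_simps)
      also have "\<dots> \<le> \<eta> + \<eta>"
        using diameter_bounded_bound[OF compact_imp_bounded[OF S(1)] z y(2)] e n
          \<open>\<bar>s - j / m\<bar> \<le> \<eta>\<close>
        by (intro add_mono) (auto simp: abs_minus_commute)
      finally show "y \<in> (\<Union>j\<le>m. Z j)" using j(1) by (auto simp: Z_def)
    qed
    have "emeasure lborel (sweep n S) \<le> emeasure lborel (\<Union>j\<le>m. Z j)"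
      by (rule emeasure_mono[OF sub]) (auto simp: Z_def)
    also have "\<dots> \<le> (\<Sum>j\<le>m. emeasure lborel (Z j))"
      by (rule emeasure_subadditive_finite) (auto simp: Z_def)
    also have "\<dots> = (\<Sum>j\<le>m. ennreal (unit_ball_vol (real DIM('a)) * (2 * \<eta>) ^ DIM('a)))"
      using e0 by (simp add: Z_def emeasure_cball)
    also have "\<dots> = ennreal (real (Suc m) * (unit_ball_vol (real DIM('a)) * (2 * \<eta>) ^ DIM('a)))"
      using e0 by (simp add: ennreal_mult ennreal_of_nat_eq_real_of_nat del: of_nat_Suc)
    also have "\<dots> \<le> ennreal ((3 / \<eta>) * (unit_ball_vol (real DIM('a)) * (2 * \<eta>) ^ DIM('a)))"
    proof (intro ennreal_leI mult_right_mono)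
      have "1 \<le> 1 / \<eta>" using e e0 by (simp add: field_simps)
      then show "real (Suc m) \<le> 3 / \<eta>" using m2 by (simp add: divide_inverse)
      show "0 \<le> unit_ball_vol (real DIM('a)) * (2 * \<eta>) ^ DIM('a)"
        using e0 by simp
    qed
    also have "(3 / \<eta>) * (unit_ball_vol (real DIM('a)) * (2 * \<eta>) ^ DIM('a)) = C * \<eta> ^ (DIM('a) - 1)"
    proof -
      have "\<eta> ^ DIM('a) = \<eta> * \<eta> ^ (DIM('a) - 1)"
        using power_minus_mult[OF DIM_positive[where 'a='a], of \<eta>] by (simp only: mult.commute)
      then have "(3 / \<eta>) * (unit_ball_vol (real DIM('a)) * (2 * \<eta>) ^ DIM('a))
          = (3 / \<eta>) * (unit_ball_vol (real DIM('a)) * (2 ^ DIM('a) * (\<eta> * \<eta> ^ (DIM('a) - 1))))"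
        by (simp only: power_mult_distrib)
      also have "\<dots> = C * \<eta> ^ (DIM('a) - 1)" using e0 by (simp add: C_def)
      finally show ?thesis .
    qed
    finally show ?thesis .
  qed
  have "emeasure lborel (sweep n S) \<le> ennreal (C * diameter S ^ (DIM('a) - 1))"
  proof (rule tendsto_lowerbound)
    show "((\<lambda>\<eta>. ennreal (C * \<eta> ^ (DIM('a) - 1))) \<longlongrightarrow> ennreal (C * diameter S ^ (DIM('a) - 1)))
        (at_right (diameter S))"
      by (intro tendsto_ennrealI tendsto_intros)
    show "\<forall>\<^sub>F \<eta> in at_right (diameter S).
        emeasure lborel (sweep n S) \<le> ennreal (C * \<eta> ^ (DIM('a) - 1))"
      using eta d unfolding eventually_at_right[OF d] by blast
  qed simp
  then show ?thesis by (simp add: C_def)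
qed

text \<open>Every countable cover of \<open>S\<close> by sets of small diameter sweeps out a cover of \<open>sweep n S\<close>, so the
  volume bound for single covering sets passes to the Hausdorff outer measure. The constant \<open>a\<close>
  depends only on the dimension.\<close>

lemma emeasure_sweep_le_hausdorff_outer:
  "\<exists>a>0. \<forall>n (S :: 'a::euclidean_space set) W. norm n = 1 \<longrightarrow> W \<subseteq> sweep n S \<longrightarrow> 
     ennreal a * emeasure lborel W \<le> hausdorff_outer (DIM('a) - 1) S"
proof -
  define k where "k = DIM('a) - 1"
  define C where "C = 3 * 2 ^ DIM('a) * unit_ball_vol (real DIM('a))"
  define a where "a = unit_ball_vol (real k) / (2 ^ k * C)"
  have C0: "0 < C" by (simp add: C_def)
  have a0: "0 < a" using C0 by (simp add: a_def)
  have "ennreal a * emeasure lborel W \<le> hausdorff_outer k S"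
    if n: "norm n = 1" and W: "W \<subseteq> sweep n S" for n :: 'a and S W
  proof -
    have "ennreal a * emeasure lborel W \<le> hausdorff_pre k (1 / 2) S"
      unfolding hausdorff_pre_def
    proof (rule INF_greatest)
      fix C' :: "nat \<Rightarrow> 'a set"
      assume "C' \<in> {C'. S \<subseteq> (\<Union>i. C' i) \<and> (\<forall>i. bounded (C' i) \<and> diameter (C' i) \<le> 1 / 2)}"
      then have C': "S \<subseteq> (\<Union>i. C' i)" "\<And>i. bounded (C' i)" "\<And>i. diameter (C' i) \<le> 1 / 2" by auto
      have cmp: "compact (closure (C' i))" for i using C'(2) by simp
      have meas: "sweep n (closure (C' i)) \<in> sets lborel" for i
        using compact_sweep[OF cmp[of i]] by (simp add: borel_compact)
      have "W \<subseteq> (\<Union>i. sweep n (closure (C' i)))"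
      proof
        fix y assume "y \<in> W"
        then obtain x s where y: "x \<in> S" "s \<in> {0..1}" "y = x + s *\<^sub>R n"
          using W by (auto simp: sweep_def)
        then obtain i where "x \<in> closure (C' i)" using C'(1) closure_subset by blast
        then have "y \<in> sweep n (closure (C' i))"
          unfolding sweep_def using y by (intro image_eqI[of _ _ "(x, s)"]) auto
        then show "y \<in> (\<Union>i. sweep n (closure (C' i)))" by blast
      qed
      then have "emeasure lborel W \<le> emeasure lborel (\<Union>i. sweep n (closure (C' i)))"
        using meas by (intro emeasure_mono) auto
      also have "\<dots> \<le> (\<Sum>i. emeasure lborel (sweep n (closure (C' i))))"
        using meas by (intro emeasure_subadditive_countably) auto
      finally have "ennreal a * emeasure lborel W
          \<le> ennreal a * (\<Sum>i. emeasure lborel (sweep n (closure (C' i))))"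
        by (rule mult_left_mono) simp
      also have "\<dots> = (\<Sum>i. ennreal a * emeasure lborel (sweep n (closure (C' i))))"
        by simp
      also have "\<dots> \<le> (\<Sum>i. hausdorff_gauge k (C' i))"
      proof (intro suminf_le)
        fix i
        show "ennreal a * emeasure lborel (sweep n (closure (C' i))) \<le> hausdorff_gauge k (C' i)"
        proof (cases "C' i = {}")
          case False
          have diam: "0 \<le> diameter (C' i)" by (rule diameter_ge_0[OF C'(2)])
          have "emeasure lborel (sweep n (closure (C' i))) \<le> ennreal (C * diameter (C' i) ^ k)"
            using emeasure_sweep_le[OF cmp[of i] _ _ n] C'(3)[of i] False
            by (simp add: diameter_closure[OF C'(2)] C_def k_def)
          then have "ennreal a * emeasure lborel (sweep n (closure (C' i)))
              \<le> ennreal a * ennreal (C * diameter (C' i) ^ k)"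
            by (rule mult_left_mono) simp
          also have "\<dots> = ennreal (a * (C * diameter (C' i) ^ k))"
            using a0 C0 diam by (simp flip: ennreal_mult)
          also have "a * (C * diameter (C' i) ^ k) = unit_ball_vol (real k) * (diameter (C' i) / 2) ^ k"
            using C0 by (simp add: a_def power_divide)
          finally show ?thesis using False by (simp add: hausdorff_gauge_def)
        qed (simp add: sweep_def)
      qed auto
      finally show "ennreal a * emeasure lborel W \<le> (\<Sum>i. hausdorff_gauge k (C' i))" .
    qed
    also have "\<dots> \<le> hausdorff_outer k S"
      unfolding hausdorff_outer_def by (intro SUP_upper) auto
    finally show ?thesis .
  qed
  then show ?thesis using a0 by (auto simp: k_def)
qed

section \<open>A coarea inequality along a direction of increase\<close>

lemma emeasure_le_of_dist_le:
  fixes X :: "real set"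
  assumes d: "0 \<le> d" "\<And>x y. x \<in> X \<Longrightarrow> y \<in> X \<Longrightarrow> \<bar>x - y\<bar> \<le> d"
  shows "emeasure lborel X \<le> ennreal d"
proof (cases "X = {}")
  case False
  then obtain a where a: "a \<in> X" by blast
  have bdd: "bdd_below X"
  proof (rule bdd_belowI)
    fix x assume "x \<in> X"
    then show "a - d \<le> x" using d(2)[OF a, of x] by linarith
  qed
  have "X \<subseteq> {Inf X..Inf X + d}"
  proof
    fix x assume x: "x \<in> X"
    have "x - d \<le> Inf X"
    proof (rule cInf_greatest[OF False])
      fix y assume "y \<in> X"
      then show "x - d \<le> y" using d(2)[OF x, of y] by linarith
    qed
    then show "x \<in> {Inf X..Inf X + d}"
      using cInf_lower[OF x bdd] by simp
  qed
  then have "emeasure lborel X \<le> emeasure lborel {Inf X..Inf X + d}"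
    by (intro emeasure_mono) auto
  then show ?thesis using d(1) by simp
qed simp

text \<open>An expanding map has a Lipschitz inverse, hence does not shrink lengths by more than the
  factor \<open>c\<close>. On a grid of width \<open>h\<close>, the preimage of a cell has diameter at most \<open>h/c\<close>; summing
  over the cells that meet \<open>T\<close> compares \<open>S\<close> with the \<open>h\<close>-neighbourhood of \<open>T\<close>, which shrinks to
  the compact set \<open>T\<close>.\<close>

lemma emeasure_expanding_image_ge:
  fixes S T :: "real set" and \<phi> :: "real \<Rightarrow> real"
  assumes S[measurable]: "S \<in> sets borel" and phi[measurable]: "\<phi> \<in> borel_measurable borel"
    and T: "compact T" "\<phi> ` S \<subseteq> T" and c: "0 < c"
    and expand: "\<And>s s'. s \<in> S \<Longrightarrow> s' \<in> S \<Longrightarrow> c * \<bar>s - s'\<bar> \<le> \<bar>\<phi> s - \<phi> s'\<bar>"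
  shows "ennreal c * emeasure lborel S \<le> emeasure lborel T"
proof (cases "S = {}")
  case False
  then have Tne: "T \<noteq> {}" using T(2) by blast
  define h where "h n = 1 / real (Suc n)" for n
  define N where "N n = {t. infdist t T \<le> h n}" for n
  have h_pos: "0 < h n" for n by (simp add: h_def)
  have N_meas: "N n \<in> sets lborel" for n
    unfolding N_def sets_lborel
    by (intro borel_closed closed_Collect_le continuous_intros)
  have bound: "ennreal c * emeasure lborel S \<le> emeasure lborel (N n)" for n
  proof -
    define I where "I j = {of_int j * h n..<(of_int j + 1) * h n}" for j :: int
    define J where "J = {j. I j \<inter> T \<noteq> {}}"
    have I_iff: "t \<in> I j \<longleftrightarrow> j = \<lfloor>t / h n\<rfloor>" for t j
      using h_pos[of n] by (auto simp: I_def field_simps floor_eq_iff eq_commute[of j])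
    have disj: "disjoint_family_on I J"
      by (auto simp: disjoint_family_on_def I_iff)
    then have disj': "disjoint_family_on (\<lambda>j. S \<inter> \<phi> -` I j) J"
      by (auto simp: disjoint_family_on_def)
    have "S = (\<Union>j\<in>J. S \<inter> \<phi> -` I j)"
    proof
      show "S \<subseteq> (\<Union>j\<in>J. S \<inter> \<phi> -` I j)"
      proof
        fix s assume "s \<in> S"
        then have "\<phi> s \<in> I \<lfloor>\<phi> s / h n\<rfloor> \<inter> T" using T(2) by (auto simp: I_iff)
        then show "s \<in> (\<Union>j\<in>J. S \<inter> \<phi> -` I j)" using \<open>s \<in> S\<close> by (auto simp: J_def)
      qed
    qed auto
    then have "emeasure lborel S = emeasure lborel (\<Union>j\<in>J. S \<inter> \<phi> -` I j)" by simp
    also have "\<dots> = (\<integral>\<^sup>+j. emeasure lborel (S \<inter> \<phi> -` I j) \<partial>count_space J)"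
    proof (rule emeasure_UN_countable[OF _ _ disj'])
      fix j
      have "\<phi> -` I j \<in> sets borel"
        using measurable_sets[OF phi, of "I j"] by (simp add: I_def)
      then show "S \<inter> \<phi> -` I j \<in> sets lborel" by simp
    qed auto
    finally have "ennreal c * emeasure lborel S
        = (\<integral>\<^sup>+j. ennreal c * emeasure lborel (S \<inter> \<phi> -` I j) \<partial>count_space J)"
      by (simp add: nn_integral_cmult)
    also have "\<dots> \<le> (\<integral>\<^sup>+j. emeasure lborel (I j) \<partial>count_space J)"
    proof (rule nn_integral_mono)
      fix j
      have "emeasure lborel (S \<inter> \<phi> -` I j) \<le> ennreal (h n / c)"
      proof (rule emeasure_le_of_dist_le)
        show "0 \<le> h n / c" using c h_pos[of n] by simp
        fix x y assume "x \<in> S \<inter> \<phi> -` I j" "y \<in> S \<inter> \<phi> -` I j"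
        then have "c * \<bar>x - y\<bar> \<le> h n"
          using expand[of x y] by (auto simp: I_def algebra_simps)
        then show "\<bar>x - y\<bar> \<le> h n / c" using c by (simp add: field_simps)
      qed
      then have "ennreal c * emeasure lborel (S \<inter> \<phi> -` I j) \<le> ennreal c * ennreal (h n / c)"
        by (rule mult_left_mono) simp
      also have "\<dots> = ennreal (h n)"
        using c h_pos[of n] by (simp flip: ennreal_mult)
      also have "\<dots> = emeasure lborel (I j)"
        using h_pos[of n] by (simp add: I_def algebra_simps)
      finally show "ennreal c * emeasure lborel (S \<inter> \<phi> -` I j) \<le> emeasure lborel (I j)" .
    qed
    also have "\<dots> = emeasure lborel (\<Union>j\<in>J. I j)"
      by (rule emeasure_UN_countable[OF _ _ disj, symmetric]) (auto simp: I_def)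
    also have "\<dots> \<le> emeasure lborel (N n)"
    proof (rule emeasure_mono[OF _ N_meas])
      show "(\<Union>j\<in>J. I j) \<subseteq> N n"
      proof
        fix t assume "t \<in> (\<Union>j\<in>J. I j)"
        then obtain j u where "t \<in> I j" "u \<in> I j" "u \<in> T" by (auto simp: J_def)
        then have "infdist t T \<le> dist t u" "dist t u \<le> h n"
          by (simp add: infdist_le, auto simp: I_def dist_real_def algebra_simps abs_le_iff)
        then show "t \<in> N n" by (simp add: N_def)
      qed
    qed
    finally show ?thesis .
  qed
  have "decseq N"
    by (auto simp: decseq_def N_def h_def elim!: order_trans intro!: frac_le)
  moreover have "emeasure lborel (N n) \<noteq> \<infinity>" for n
  proof -
    have "bounded (N n)"
    proof -
      obtain B where B: "\<And>t. t \<in> T \<Longrightarrow> \<bar>t\<bar> \<le> B"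
        using compact_imp_bounded[OF T(1)] by (auto simp: bounded_iff)
      have "\<bar>t\<bar> \<le> B + h n" if "t \<in> N n" for t
      proof -
        obtain u where "u \<in> T" "infdist t T = dist t u"
          using infdist_attains_inf[OF compact_imp_closed[OF T(1)] Tne, of t] by blast
        then show ?thesis using that B[of u] by (auto simp: N_def dist_real_def)
      qed
      then show ?thesis unfolding bounded_iff by (auto intro!: exI[of _ "B + h n"])
    qed
    then show ?thesis using emeasure_bounded_finite[of "N n"] by auto
  qed
  ultimately have "(\<lambda>n. emeasure lborel (N n)) \<longlonglongrightarrow> emeasure lborel (\<Inter>n. N n)"
    by (intro Lim_emeasure_decseq) (use N_meas in auto)
  moreover have "(\<Inter>n. N n) = T"
  proof
    show "(\<Inter>n. N n) \<subseteq> T"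
    proof
      fix t assume "t \<in> (\<Inter>n. N n)"
      then have "infdist t T \<le> h n" for n by (auto simp: N_def)
      then have "infdist t T \<le> 0"
        unfolding h_def by (intro LIMSEQ_le_const[OF LIMSEQ_Suc[OF lim_1_over_n]]) auto
      then show "t \<in> T"
        using in_closed_iff_infdist_zero[OF compact_imp_closed[OF T(1)] Tne, of t] infdist_nonneg[of t T]
        by auto
    qed
    show "T \<subseteq> (\<Inter>n. N n)" using h_pos by (auto simp: N_def intro: less_imp_le)
  qed
  ultimately show ?thesis
    using bound by (auto intro: LIMSEQ_le_const)
qed simp

text \<open>Both sides are measured inside the space of pairs. The set \<open>G\<close> of all \<open>(x + s n, \<delta> x)\<close> with
  \<open>x \<in> A\<close> and \<open>s \<in> [0, 1]\<close> has the swept level sets as slices at fixed \<open>t\<close>, whereas \<open>H\<close>, the set of all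
  \<open>(x + s n, s)\<close>, has translates of \<open>A\<close> as slices and so has measure \<open>|A|\<close>. Over a fixed point \<open>y\<close>
  the map \<open>s \<mapsto> \<delta> (y - s n)\<close> takes the fibre of \<open>H\<close> into the fibre of \<open>G\<close> and expands distances by
  \<open>c\<close>. Compactness of \<open>A\<close> makes \<open>G\<close> and \<open>H\<close> measurable although they are defined as images.\<close>

lemma coarea_sweep_inequality:
  fixes A :: "'a::euclidean_space set" and \<delta> :: "'a \<Rightarrow> real"
  assumes A: "compact A" and cont: "continuous_on UNIV \<delta>" and c: "0 < c"
    and incr: "\<And>x s. x \<in> A \<Longrightarrow> 0 \<le> s \<Longrightarrow> x + s *\<^sub>R n \<in> A \<Longrightarrow> \<delta> x + c * s \<le> \<delta> (x + s *\<^sub>R n)"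
  shows "(\<lambda>t. emeasure lborel (sweep n {x \<in> A. \<delta> x = t})) \<in> borel_measurable borel"
    and "ennreal c * emeasure lborel A \<le> (\<integral>\<^sup>+t. emeasure lborel (sweep n {x \<in> A. \<delta> x = t}) \<partial>lborel)"
proof -
  define G where "G = (\<lambda>(x, s). (x + s *\<^sub>R n, \<delta> x)) ` (A \<times> {0..1})"
  define H where "H = (\<lambda>(x, s). (x + s *\<^sub>R n, s)) ` (A \<times> {0..1::real})"
  have H_mem: "(y, s) \<in> H \<longleftrightarrow> s \<in> {0..1} \<and> y - s *\<^sub>R n \<in> A" for y s
    by (auto simp: H_def intro!: image_eqI[of _ _ "(y - s *\<^sub>R n, s)"])
  have cont_fst: "continuous_on X (\<lambda>p. \<delta> (fst p))" for X :: "('a \<times> real) set"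
    by (rule continuous_on_compose2[OF cont]) (auto intro: continuous_intros)
  have G_compact: "compact G" unfolding G_def
    by (intro compact_continuous_image compact_Times A)
       (auto simp: split_def intro!: continuous_intros cont_fst)
  have H_compact: "compact H" unfolding H_def
    by (intro compact_continuous_image compact_Times A)
       (auto simp: split_def intro!: continuous_intros)
  have meas: "X \<in> sets (lborel \<Otimes>\<^sub>M lborel)" if "compact X" for X :: "('a \<times> real) set"
    using borel_compact[OF that] by (metis lborel_prod sets_lborel)
  have G_level: "(\<lambda>y. (y, t)) -` G = sweep n {x \<in> A. \<delta> x = t}" for t
    by (auto simp: G_def sweep_def image_iff)
  have "(\<lambda>t. emeasure lborel ((\<lambda>y. (y, t)) -` G)) \<in> borel_measurable lborel"
    by (rule lborel_pair.measurable_emeasure_Pair2[OF meas[OF G_compact]])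
  then show "(\<lambda>t. emeasure lborel (sweep n {x \<in> A. \<delta> x = t})) \<in> borel_measurable borel"
    by (simp add: G_level)
  have fibre: "ennreal c * emeasure lborel (Pair y -` H) \<le> emeasure lborel (Pair y -` G)" for y
  proof (rule emeasure_expanding_image_ge[where \<phi> = "\<lambda>s. \<delta> (y - s *\<^sub>R n)"])
    have "Pair y -` H = snd ` (H \<inter> {y} \<times> UNIV)" by force
    moreover have "compact (H \<inter> {y} \<times> UNIV)"
      by (intro compact_Int_closed H_compact closed_Times) auto
    ultimately have "compact (Pair y -` H)"
      by (simp add: compact_continuous_image continuous_on_snd)
    then show "Pair y -` H \<in> sets borel" by (rule borel_compact)
    have "Pair y -` G = snd ` (G \<inter> {y} \<times> UNIV)" by force
    moreover have "compact (G \<inter> {y} \<times> UNIV)"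
      by (intro compact_Int_closed G_compact closed_Times) auto
    ultimately show "compact (Pair y -` G)"
      by (simp add: compact_continuous_image continuous_on_snd)
    have "continuous_on UNIV (\<lambda>s. \<delta> (y - s *\<^sub>R n))"
      by (rule continuous_on_compose2[OF cont]) (auto intro!: continuous_intros)
    then show "(\<lambda>s. \<delta> (y - s *\<^sub>R n)) \<in> borel_measurable borel"
      by (rule borel_measurable_continuous_onI)
    have H_iff: "s \<in> Pair y -` H \<longleftrightarrow> s \<in> {0..1} \<and> y - s *\<^sub>R n \<in> A" for s
      by (simp add: H_mem)
    show "(\<lambda>s. \<delta> (y - s *\<^sub>R n)) ` (Pair y -` H) \<subseteq> Pair y -` G"
    proof
      fix t assume "t \<in> (\<lambda>s. \<delta> (y - s *\<^sub>R n)) ` (Pair y -` H)"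
      then obtain s where "s \<in> {0..1}" "y - s *\<^sub>R n \<in> A" "t = \<delta> (y - s *\<^sub>R n)"
        using H_iff by auto
      then show "t \<in> Pair y -` G"
        by (auto simp: G_def intro!: image_eqI[of _ _ "(y - s *\<^sub>R n, s)"])
    qed
    show "0 < c" by (rule c)
    have le: "c * (s' - s) \<le> \<delta> (y - s *\<^sub>R n) - \<delta> (y - s' *\<^sub>R n)"
      if "s \<in> Pair y -` H" "s' \<in> Pair y -` H" "s \<le> s'" for s s'
      using incr[of "y - s' *\<^sub>R n" "s' - s"] that(3)
        that(1,2)[unfolded H_iff] by (simp add: scaleR_diff_left)
    fix s s' assume "s \<in> Pair y -` H" "s' \<in> Pair y -` H"
    then show "c * \<bar>s - s'\<bar> \<le> \<bar>\<delta> (y - s *\<^sub>R n) - \<delta> (y - s' *\<^sub>R n)\<bar>"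
      using le[of s s'] le[of s' s] by (cases "s \<le> s'") auto
  qed
  have slice: "emeasure lborel ((\<lambda>y. (y, s)) -` H) = emeasure lborel A * indicator {0..1} s" for s
  proof (cases "s \<in> {0..1}")
    case True
    have "(\<lambda>y. (y, s)) -` H = (+) (- (s *\<^sub>R n)) -` A"
      using True by (auto simp: H_mem)
    then have "emeasure lborel ((\<lambda>y. (y, s)) -` H)
        = emeasure (distr lborel borel ((+) (- (s *\<^sub>R n)))) A"
      using borel_compact[OF A] by (simp add: emeasure_distr)
    also have "\<dots> = emeasure lborel A" by (simp add: lborel_distr_plus)
    finally show ?thesis using True by simp
  next
    case False
    then have "(\<lambda>y. (y, s)) -` H = {}" by (auto simp: H_def)
    then show ?thesis using False by simp
  qed
  have "emeasure lborel A = (\<integral>\<^sup>+s. emeasure lborel A * indicator {0..1} s \<partial>(lborel :: real measure))"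
    by (simp add: nn_integral_cmult)
  also have "\<dots> = (\<integral>\<^sup>+s. emeasure lborel ((\<lambda>y. (y, s)) -` H) \<partial>lborel)"
    by (simp only: slice)
  also have "\<dots> = emeasure (lborel \<Otimes>\<^sub>M lborel) H"
    by (rule lborel_pair.emeasure_pair_measure_alt2[OF meas[OF H_compact], symmetric])
  also have "\<dots> = (\<integral>\<^sup>+y. emeasure lborel (Pair y -` H) \<partial>lborel)"
    by (rule lborel.emeasure_pair_measure_alt[OF meas[OF H_compact]])
  finally have "ennreal c * emeasure lborel A
      = (\<integral>\<^sup>+y. ennreal c * emeasure lborel (Pair y -` H) \<partial>lborel)"
    using lborel.measurable_emeasure_Pair[OF meas[OF H_compact]] by (simp add: nn_integral_cmult)
  also have "\<dots> \<le> (\<integral>\<^sup>+y. emeasure lborel (Pair y -` G) \<partial>lborel)"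
    by (intro nn_integral_mono fibre)
  also have "\<dots> = emeasure (lborel \<Otimes>\<^sub>M lborel) G"
    by (rule lborel.emeasure_pair_measure_alt[OF meas[OF G_compact], symmetric])
  also have "\<dots> = (\<integral>\<^sup>+t. emeasure lborel ((\<lambda>y. (y, t)) -` G) \<partial>lborel)"
    by (rule lborel_pair.emeasure_pair_measure_alt2[OF meas[OF G_compact]])
  finally show "ennreal c * emeasure lborel A \<le> (\<integral>\<^sup>+t. emeasure lborel (sweep n {x \<in> A. \<delta> x = t}) \<partial>lborel)"
    by (simp only: G_level)
qed

(*CUT*)

text \<open>Slicing bound for a density \<open>f\<close>. Since \<open>f\<close> is only Lebesgue measurable, its restriction to a level
  set need not be Hausdorff measurable, and the slice integral is then a lower integral. It still
  dominates the integral of any step function below \<open>f\<close> whose steps are compact, because closed sets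
  are Hausdorff measurable; such step functions are enough by inner regularity of Lebesgue measure.\<close>

lemma nn_integral_le_of_slices_le:
  fixes f :: "'a::euclidean_space \<Rightarrow> real" and V :: "'a set"
  assumes a: "0 < a" "\<And>(S :: 'a set) W. W \<subseteq> sweep n S \<Longrightarrow>
        ennreal a * emeasure lborel W \<le> hausdorff_outer (DIM('a) - 1) S"
    and V: "V \<in> sets lebesgue" "bounded V" and f: "f \<in> borel_measurable (lebesgue_on V)"
    and cont: "continuous_on UNIV \<delta>" and range: "\<And>x. x \<in> V \<Longrightarrow> \<delta> x \<in> {0..r}" and r: "0 \<le> r"
    and c: "0 < c" and incr: "\<And>x s. x \<in> V \<Longrightarrow> 0 \<le> s \<Longrightarrow> x + s *\<^sub>R n \<in> V \<Longrightarrow>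
        \<delta> x + c * s \<le> \<delta> (x + s *\<^sub>R n)"
    and slices: "AE t in lebesgue_on {0..r}.
        (\<integral>\<^sup>+x\<in>{x \<in> V. \<delta> x = t}. ennreal (f x) \<partial>hausdorff_measure (DIM('a) - 1)) \<le> K"
  shows "ennreal (a * c) * (\<integral>\<^sup>+x. ennreal (f x) \<partial>lebesgue_on V) \<le> K * ennreal r"
proof -
  let ?H = "hausdorff_measure (DIM('a) - 1) :: 'a measure"
  have step: "(\<Sum>v\<in>I. v * (ennreal (a * c) * emeasure lborel (A v))) \<le> K * ennreal r"
    if I: "finite I" and A: "\<And>v. v \<in> I \<Longrightarrow> compact (A v)" "\<And>v. v \<in> I \<Longrightarrow> A v \<subseteq> V"
      and disj: "disjoint_family_on A I"
      and below: "\<And>v x. v \<in> I \<Longrightarrow> x \<in> A v \<Longrightarrow> v \<le> ennreal (f x)"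
    for I :: "ennreal set" and A :: "ennreal \<Rightarrow> 'a set"
  proof -
    define L where "L v t = {x \<in> A v. \<delta> x = t}" for v t
    define F where "F t = (\<Sum>v\<in>I. v * (ennreal a * emeasure lborel (sweep n (L v t))))" for t
    have incr_A: "\<delta> x + c * s \<le> \<delta> (x + s *\<^sub>R n)"
      if "v \<in> I" "x \<in> A v" "0 \<le> s" "x + s *\<^sub>R n \<in> A v" for v x s
      using that A(2) by (intro incr) auto
    have meas[measurable]: "(\<lambda>t. emeasure lborel (sweep n (L v t))) \<in> borel_measurable borel"
      if "v \<in> I" for v
      unfolding L_def using that by (intro coarea_sweep_inequality(1)[OF A(1) cont c incr_A])
    have L_closed: "closed (L v t)" if "v \<in> I" for v t
    proof -
      have "closed {x. \<delta> x = t}" by (intro closed_Collect_eq cont continuous_on_const)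
      then have "closed (A v \<inter> {x. \<delta> x = t})"
        by (rule closed_Int[OF compact_imp_closed[OF A(1)[OF that]]])
      then show ?thesis by (simp add: L_def Collect_conj_eq)
    qed
    have F_slice: "F t \<le> (\<integral>\<^sup>+x\<in>{x \<in> V. \<delta> x = t}. ennreal (f x) \<partial>?H)" for t
    proof -
      have "F t \<le> (\<Sum>v\<in>I. v * emeasure ?H (L v t))"
        unfolding F_def
      proof (intro sum_mono mult_left_mono)
        fix v assume "v \<in> I"
        have "emeasure ?H (L v t) = hausdorff_outer (DIM('a) - 1) (L v t)"
          using closed_in_sets_hausdorff_measure[OF L_closed[OF \<open>v \<in> I\<close>]]
          by (intro emeasure_hausdorff_measure) (simp add: sets_hausdorff_measure)
        then show "ennreal a * emeasure lborel (sweep n (L v t)) \<le> emeasure ?H (L v t)"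
          using a(2)[of "sweep n (L v t)" "L v t"] by simp
      qed simp
      also have "\<dots> = (\<Sum>v\<in>I. \<integral>\<^sup>+x. v * indicator (L v t) x \<partial>?H)"
        using closed_in_sets_hausdorff_measure[OF L_closed]
        by (intro sum.cong refl nn_integral_cmult_indicator[symmetric])
      also have "\<dots> = (\<integral>\<^sup>+x. (\<Sum>v\<in>I. v * indicator (L v t) x) \<partial>?H)"
        using closed_in_sets_hausdorff_measure[OF L_closed]
        by (intro nn_integral_sum[symmetric] borel_measurable_times_ennreal
            borel_measurable_indicator borel_measurable_const)
      also have "\<dots> \<le> (\<integral>\<^sup>+x\<in>{x \<in> V. \<delta> x = t}. ennreal (f x) \<partial>?H)"
      proof (rule nn_integral_mono)
        fix x
        show "(\<Sum>v\<in>I. v * indicator (L v t) x) \<le> ennreal (f x) * indicator {x \<in> V. \<delta> x = t} x"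
        proof (cases "\<exists>v\<in>I. x \<in> L v t")
          case True
          then obtain v where v: "v \<in> I" "x \<in> L v t" by blast
          have "x \<notin> L w t" if "w \<in> I" "w \<noteq> v" for w
            using disj v that by (auto simp: disjoint_family_on_def L_def)
          then have "(\<Sum>w\<in>I. w * indicator (L w t) x) = (\<Sum>w\<in>{v}. w * indicator (L w t) x)"
            using v I by (intro sum.mono_neutral_right) (auto simp: indicator_def)
          also have "\<dots> = v" using v(2) by simp
          also have "v \<le> ennreal (f x)" using v by (intro below) (auto simp: L_def)
          also have "\<dots> = ennreal (f x) * indicator {x \<in> V. \<delta> x = t} x"
            using v A(2)[OF v(1)] by (auto simp: L_def)
          finally show ?thesis .
        next
          case False
          then have "(\<Sum>v\<in>I. v * indicator (L v t) x) = 0"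
            by (intro sum.neutral) auto
          then show ?thesis by simp
        qed
      qed
      finally show ?thesis .
    qed
    have F_zero: "F t = 0" if "t \<notin> {0..r}" for t
    proof -
      have "L v t = {}" if "v \<in> I" for v
        using A(2)[OF that] range \<open>t \<notin> {0..r}\<close> by (auto simp: L_def)
      then show ?thesis by (simp add: F_def sweep_def)
    qed
    have "AE t in lebesgue. t \<in> {0..r} \<longrightarrow> F t \<le> K"
      using slices by (subst (asm) AE_restrict_space_iff)
        (auto elim!: eventually_mono intro: order_trans[OF F_slice])
    then have F_le: "AE t in lebesgue. F t \<le> K * indicator {0..r} t"
      by eventually_elim (auto simp: indicator_def F_zero)
    have "(\<Sum>v\<in>I. v * (ennreal (a * c) * emeasure lborel (A v)))
        = (\<Sum>v\<in>I. v * (ennreal a * (ennreal c * emeasure lborel (A v))))"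
      using a(1) c by (simp add: ennreal_mult mult.assoc)
    also have "\<dots> \<le> (\<Sum>v\<in>I. v * (ennreal a * (\<integral>\<^sup>+t. emeasure lborel (sweep n (L v t)) \<partial>lborel)))"
      unfolding L_def
      by (intro sum_mono mult_left_mono coarea_sweep_inequality(2)[OF A(1) cont c incr_A]) auto
    also have "\<dots> = (\<Sum>v\<in>I. \<integral>\<^sup>+t. v * (ennreal a * emeasure lborel (sweep n (L v t))) \<partial>lborel)"
      by (intro sum.cong refl) (simp add: nn_integral_cmult)
    also have "\<dots> = (\<integral>\<^sup>+t. F t \<partial>lborel)"
      unfolding F_def by (intro nn_integral_sum[symmetric]) simp
    also have "\<dots> = (\<integral>\<^sup>+t. F t \<partial>lebesgue)" by (simp add: nn_integral_completion)
    also have "\<dots> \<le> (\<integral>\<^sup>+t. K * indicator {0..r} t \<partial>lebesgue)"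
      by (rule nn_integral_mono_AE[OF F_le])
    also have "\<dots> = K * ennreal r"
      using r by (subst nn_integral_cmult_indicator) auto
    finally show ?thesis .
  qed
  show ?thesis
    unfolding nn_integral_def SUP_mult_left_ennreal
  proof (rule SUP_least)
    fix g assume "g \<in> {g. simple_function (lebesgue_on V) g \<and> g \<le> (\<lambda>x. ennreal (f x))}"
    then have g: "simple_function (lebesgue_on V) g" "\<And>x. g x \<le> ennreal (f x)"
      by (auto simp: le_fun_def)
    define B where "B v = g -` {v} \<inter> V" for v
    have fin: "finite (g ` V)" using simple_functionD(1)[OF g(1)] by (simp add: space_restrict_space)
    have B_sets: "B v \<in> sets lebesgue" for v
      using simple_functionD(2)[OF g(1), of "{v}"] V(1)
      by (auto simp: B_def space_restrict_space sets_restrict_space_iff)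
    have "\<exists>T. compact T \<and> T \<subseteq> B v \<and> emeasure lebesgue (B v) \<le> emeasure lborel T + ennreal (1 / Suc m)" for v m
    proof -
      obtain T where T: "closed T" "T \<subseteq> B v" "B v - T \<in> lmeasurable"
          "emeasure lebesgue (B v - T) < ennreal (1 / Suc m)"
        using sets_lebesgue_inner_closed[OF B_sets[of v], of "1 / Suc m"] by auto
      have "bounded T" using bounded_subset[OF V(2), of T] T(2) by (auto simp: B_def)
      then have "compact T" using T(1) by (simp add: compact_eq_bounded_closed)
      have "emeasure lebesgue (B v) = emeasure lebesgue (T \<union> (B v - T))"
        using T(2) by (simp add: Un_absorb1)
      also have "\<dots> \<le> emeasure lebesgue T + emeasure lebesgue (B v - T)"
        using T B_sets by (intro emeasure_subadditive) (auto intro: fmeasurableD)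
      also have "\<dots> \<le> emeasure lborel T + ennreal (1 / Suc m)"
        using T(4) borel_compact[OF \<open>compact T\<close>] by (intro add_mono) auto
      finally show ?thesis using T(2) \<open>compact T\<close> by blast
    qed
    then obtain A where A: "\<And>v m. compact (A v m)" "\<And>v m. A v m \<subseteq> B v"
        "\<And>v m. emeasure lebesgue (B v) \<le> emeasure lborel (A v m) + ennreal (1 / Suc m)"
      by metis
    have inB: "x \<in> V \<and> g x = v" if "x \<in> A v m" for v m x
      using A(2)[of v m] that by (auto simp: B_def)
    \<comment> \<open>\<open>D\<close> is the factor by which the approximation error of the compact sets is multiplied.\<close>
    define D where "D = (\<Sum>v\<in>g ` V. v)"
    have D: "ennreal (a * c) * D \<noteq> top"
    proof -
      have "v < top" if "v \<in> g ` V" for v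
        using that by (auto intro: order_le_less_trans[OF g(2)])
      then show ?thesis using fin by (auto simp: D_def ennreal_mult_eq_top_iff)
    qed
    have bound: "ennreal (a * c) * integral\<^sup>S (lebesgue_on V) g \<le> K * ennreal r + ennreal (a * c) * D * ennreal (1 / Suc m)" for m
    proof -
      have "integral\<^sup>S (lebesgue_on V) g = (\<Sum>v\<in>g ` V. v * emeasure lebesgue (B v))"
        unfolding simple_integral_def using V(1)
        by (simp add: space_restrict_space B_def emeasure_restrict_space)
      also have "\<dots> \<le> (\<Sum>v\<in>g ` V. v * (emeasure lborel (A v m) + ennreal (1 / Suc m)))"
        by (intro sum_mono mult_left_mono A(3)) simp
      finally have "ennreal (a * c) * integral\<^sup>S (lebesgue_on V) g
          \<le> ennreal (a * c) * (\<Sum>v\<in>g ` V. v * (emeasure lborel (A v m) + ennreal (1 / Suc m)))"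
        by (rule mult_left_mono) simp
      also have "\<dots> = (\<Sum>v\<in>g ` V. v * (ennreal (a * c) * emeasure lborel (A v m))) + ennreal (a * c) * D * ennreal (1 / Suc m)"
        by (simp add: D_def sum_distrib_left sum_distrib_right distrib_left sum.distrib mult_ac)
      also have "\<dots> \<le> K * ennreal r + ennreal (a * c) * D * ennreal (1 / Suc m)"
      proof (intro add_right_mono step fin A(1))
        show "disjoint_family_on (\<lambda>v. A v m) (g ` V)"
          unfolding disjoint_family_on_def by (metis disjoint_iff inB)
        show "A v m \<subseteq> V" for v using inB by blast
        show "v \<le> ennreal (f x)" if "x \<in> A v m" for v x
          using inB[OF that] g(2)[of x] by simp
      qed
      finally show ?thesis .
    qed
    have "(\<lambda>m. K * ennreal r + ennreal (a * c) * D * ennreal (1 / Suc m)) \<longlonglongrightarrow>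
        K * ennreal r + ennreal (a * c) * D * ennreal 0"
      by (intro tendsto_add tendsto_const ennreal_tendsto_cmult tendsto_ennrealI
          LIMSEQ_Suc[OF lim_1_over_n]) (use D in \<open>simp add: less_top\<close>)
    from LIMSEQ_le_const[OF this, of "ennreal (a * c) * integral\<^sup>S (lebesgue_on V) g"]
    show "ennreal (a * c) * integral\<^sup>S (lebesgue_on V) g \<le> K * ennreal r"
      using bound by simp
  qed
qed

section \<open>Mass near a Lipschitz boundary\<close>

lemma ball_boundary_dist_subset:
  assumes "open \<Omega>" "x \<in> \<Omega>"
  shows "ball x (boundary_dist \<Omega> x) \<subseteq> (\<Omega> :: 'a::euclidean_space set)"
proof (rule ccontr)
  assume not_sub: "\<not> ?thesis"
  then have "0 < boundary_dist \<Omega> x" by (metis ball_empty empty_subsetI not_le)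
  then have "ball x (boundary_dist \<Omega> x) \<inter> \<Omega> \<noteq> {}"
    using assms(2) centre_in_ball by blast
  with not_sub obtain q where q: "q \<in> ball x (boundary_dist \<Omega> x)" "q \<in> frontier \<Omega>"
    using connected_Int_frontier[of "ball x (boundary_dist \<Omega> x)" \<Omega>] by auto
  then show False
    using infdist_le[of q "frontier \<Omega>" x] by (simp add: boundary_dist_def)
qed

lemma boundary_dist_ge_if_ball_subset:
  assumes "open \<Omega>" "frontier \<Omega> \<noteq> {}" "ball y R \<subseteq> \<Omega>"
  shows "R \<le> boundary_dist \<Omega> y"
  unfolding boundary_dist_def infdist_notempty[OF assms(2)]
proof (rule cINF_greatest[OF assms(2)])
  fix q assume "q \<in> frontier \<Omega>"
  then have "q \<notin> \<Omega>" using assms(1) by (simp add: frontier_def interior_open)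
  then show "R \<le> dist y q" using assms(3) by (force simp: not_less)
qed

text \<open>A point \<open>z\<close> at distance less than \<open>\<delta> x + c s\<close> from \<open>x + s n\<close> arises from a point \<open>u \<in> \<Omega>\<close> of
  the ball of radius \<open>\<delta> x\<close> around \<open>x\<close> by adding \<open>s n\<close> and a vector \<open>v\<close> of length at most \<open>c s\<close>. For
  \<open>c = 1/(1 + 2 L)\<close> the step \<open>s n + v\<close> rises at least as fast as the graph of \<open>\<gamma>\<close> can, so \<open>z\<close> stays
  above the graph. The radius \<open>r/4\<close> keeps all the points involved inside the ball where \<open>\<Omega>\<close> is an
  epigraph.\<close>

lemma boundary_dist_increasing_locally:
  fixes \<Omega> :: "'a::euclidean_space set"
  assumes "open \<Omega>" and lip: "lipschitz_boundary \<Omega>" and p: "p \<in> frontier \<Omega>"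
  shows "\<exists>\<rho>>0. \<exists>n. \<exists>c>0. norm n = 1 \<and>
    (\<forall>x s. x \<in> \<Omega> \<inter> ball p \<rho> \<longrightarrow> 0 \<le> s \<longrightarrow> x + s *\<^sub>R n \<in> ball p \<rho> \<longrightarrow>
      boundary_dist \<Omega> x + c * s \<le> boundary_dist \<Omega> (x + s *\<^sub>R n))"
proof -
  obtain r n \<gamma> L where r: "0 < r" and n: "norm n = 1" and L: "L-lipschitz_on {y. y \<bullet> n = 0} \<gamma>"
    and graph: "\<Omega> \<inter> ball p r = {x \<in> ball p r. \<gamma> (x - (x \<bullet> n) *\<^sub>R n) < x \<bullet> n}"
    using lip p unfolding lipschitz_boundary_def by blast
  have nn: "n \<bullet> n = 1" using n by (simp add: norm_eq_1)
  have L0: "0 \<le> L" using L by (simp add: lipschitz_on_def)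
  define c where "c = 1 / (1 + 2 * L)"
  have c: "0 < c" "2 * L * c = 1 - c" using L0 by (auto simp: c_def field_simps)
  have in_Omega_iff: "x \<in> \<Omega> \<longleftrightarrow> \<gamma> (x - (x \<bullet> n) *\<^sub>R n) < x \<bullet> n" if "x \<in> ball p r" for x
    using graph that by blast
  have "boundary_dist \<Omega> x + c * s \<le> boundary_dist \<Omega> (x + s *\<^sub>R n)"
    if x: "x \<in> \<Omega>" "x \<in> ball p (r / 4)" and s: "0 \<le> s" and xs: "x + s *\<^sub>R n \<in> ball p (r / 4)" for x s
  proof (rule boundary_dist_ge_if_ball_subset[OF assms(1)])
    define d where "d = boundary_dist \<Omega> x"
    have d: "0 \<le> d" "d < r / 4"
      using infdist_le[OF p, of x] x(2) by (auto simp: d_def boundary_dist_def infdist_nonneg dist_commute)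
    have "s = dist x (x + s *\<^sub>R n)" using s n by (simp add: dist_norm)
    also have "\<dots> \<le> dist p x + dist p (x + s *\<^sub>R n)" by (metis dist_commute dist_triangle)
    finally have s_less: "s < r / 2" using x(2) xs by simp
    have cs: "0 \<le> c * s" "c * s \<le> s" using c L0 s by (auto simp: c_def field_simps)
    show "ball (x + s *\<^sub>R n) (boundary_dist \<Omega> x + c * s) \<subseteq> \<Omega>"
    proof
      fix z assume z: "z \<in> ball (x + s *\<^sub>R n) (boundary_dist \<Omega> x + c * s)"
      define R where "R = d + c * s"
      define w where "w = z - (x + s *\<^sub>R n)"
      have w: "norm w < R" using z by (simp add: w_def R_def d_def dist_norm norm_minus_commute)
      have R0: "0 < R" using w by (meson norm_ge_zero order_le_less_trans)
      \<comment> \<open>Split the displacement \<open>w\<close> into a part that stays in the ball of radius \<open>d\<close> around \<open>x\<close>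
        and a part short enough to be absorbed by the step \<open>s\<close> along \<open>n\<close>.\<close>
      define u where "u = x + (d / R) *\<^sub>R w"
      define v where "v = (c * s / R) *\<^sub>R w"
      have z_eq: "z = u + s *\<^sub>R n + v"
      proof -
        have "d / R + c * s / R = 1" using R0 by (simp add: R_def add_divide_distrib[symmetric])
        then have "w = (d / R) *\<^sub>R w + (c * s / R) *\<^sub>R w"
          by (metis scaleR_add_left scaleR_one)
        then show ?thesis by (simp add: u_def v_def w_def algebra_simps)
      qed
      have v: "norm v \<le> c * s"
      proof -
        have "norm v = c * s * (norm w / R)" using R0 c(1) s by (simp add: v_def abs_mult)
        also have "\<dots> \<le> c * s * 1" using w R0 cs by (intro mult_left_mono) auto
        finally show ?thesis by simp
      qed
      have u: "u \<in> \<Omega>" "dist x u \<le> d"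
      proof -
        have du: "dist x u = d * (norm w / R)" using R0 d by (simp add: u_def dist_norm)
        also have "\<dots> \<le> d * 1" using w R0 d by (intro mult_left_mono) auto
        finally show "dist x u \<le> d" by simp
        show "u \<in> \<Omega>"
        proof (cases "d = 0")
          case False
          then have "d * (norm w / R) < d * 1" using w R0 d by (intro mult_strict_left_mono) auto
          then show ?thesis
            using ball_boundary_dist_subset[OF assms(1) x(1)] du by (auto simp: d_def)
        qed (simp add: u_def x(1))
      qed
      have "dist p u \<le> dist p x + dist x u" by (rule dist_triangle)
      then have u_ball: "u \<in> ball p r" using u(2) x(2) d r by simp
      have "dist p z \<le> dist p (x + s *\<^sub>R n) + dist (x + s *\<^sub>R n) z" by (rule dist_triangle)
      then have z_ball: "z \<in> ball p r"
        using z xs d cs s_less by (simp add: d_def)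
      have "\<gamma> (z - (z \<bullet> n) *\<^sub>R n) - \<gamma> (u - (u \<bullet> n) *\<^sub>R n) \<le> L * dist (z - (z \<bullet> n) *\<^sub>R n) (u - (u \<bullet> n) *\<^sub>R n)"
        using lipschitz_onD[OF L, of "z - (z \<bullet> n) *\<^sub>R n" "u - (u \<bullet> n) *\<^sub>R n"] nn
        by (simp add: inner_diff_left dist_real_def)
      also have "\<dots> = L * norm (v - (v \<bullet> n) *\<^sub>R n)"
        by (simp add: z_eq dist_norm inner_add_left nn algebra_simps)
      also have "\<dots> \<le> L * (2 * (c * s))"
      proof (rule mult_left_mono[OF _ L0])
        have "norm (v - (v \<bullet> n) *\<^sub>R n) \<le> norm v + norm ((v \<bullet> n) *\<^sub>R n)" by (rule norm_triangle_ineq4)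
        also have "norm ((v \<bullet> n) *\<^sub>R n) \<le> norm v" using Cauchy_Schwarz_ineq2[of v n] n by simp
        finally show "norm (v - (v \<bullet> n) *\<^sub>R n) \<le> 2 * (c * s)" using v by simp
      qed
      also have "\<dots> = (2 * L * c) * s" by (simp only: mult_ac)
      also have "\<dots> = s - c * s" unfolding c(2) by (simp add: algebra_simps)
      finally have "\<gamma> (z - (z \<bullet> n) *\<^sub>R n) < u \<bullet> n + s - c * s"
        using in_Omega_iff[OF u_ball] u(1) by linarith
      also have "\<dots> \<le> z \<bullet> n"
        using Cauchy_Schwarz_ineq2[of v n] v n by (simp add: z_eq inner_add_left nn)
      finally show "z \<in> \<Omega>" using in_Omega_iff[OF z_ball] by blast
    qed
  qed (use p in auto)
  then show ?thesis using r n c(1) by (intro exI[of _ "r / 4"]) auto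
qed

lemma boundary_dist_pos:
  assumes "open \<Omega>" "frontier \<Omega> \<noteq> {}" "x \<in> \<Omega>"
  shows "0 < boundary_dist \<Omega> x"
proof -
  have "x \<notin> frontier \<Omega>" using assms by (simp add: frontier_def interior_open)
  then show ?thesis
    using in_closed_iff_infdist_zero[OF frontier_closed assms(2), of x] infdist_nonneg[of x "frontier \<Omega>"]
    by (auto simp: boundary_dist_def less_le)
qed

lemma continuous_on_boundary_dist: "continuous_on S (boundary_dist \<Omega>)"
  unfolding boundary_dist_def by (intro continuous_intros)

lemma frontier_nonempty_of_bounded_lipschitz_domain:
  fixes \<Omega> :: "'a::euclidean_space set"
  assumes "bounded_lipschitz_domain \<Omega>"
  shows "frontier \<Omega> \<noteq> {}"
  using assms not_bounded_UNIV[where 'a='a]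
  by (intro frontier_not_empty) (auto simp: bounded_lipschitz_domain_def)

text \<open>The boundary is covered by finitely many patches in which \<open>\<delta>\<close> increases along a fixed
  direction, and they contain a whole layer \<open>{\<delta> < r}\<close>. In each patch the slicing bound applies with
  the essential supremum as bound on the slices.\<close>

lemma boundary_layer_mass_le:
  fixes \<Omega> :: "'a::euclidean_space set" and \<omega> :: "'a \<Rightarrow> real"
  assumes dom: "bounded_lipschitz_domain \<Omega>"
    and meas: "\<omega> \<in> borel_measurable (lebesgue_on \<Omega>)"
    and eps: "0 < \<epsilon>" and fin: "K_level \<Omega> \<omega> \<epsilon> < \<infinity>"
  shows "\<exists>C r\<^sub>1. 0 \<le> C \<and> 0 < r\<^sub>1 \<and> (\<forall>r. 0 < r \<longrightarrow> r \<le> r\<^sub>1 \<longrightarrow>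
    emeasure (density (lebesgue_on \<Omega>) (\<lambda>x. ennreal (\<omega> x))) {x \<in> \<Omega>. boundary_dist \<Omega> x < r} \<le> ennreal (C * r))"
proof -
  let ?M = "density (lebesgue_on \<Omega>) (\<lambda>x. ennreal (\<omega> x))"
  let ?\<delta> = "boundary_dist \<Omega>"
  have \<Omega>: "open \<Omega>" "bounded \<Omega>" "lipschitz_boundary \<Omega>"
    using dom by (auto simp: bounded_lipschitz_domain_def)
  have ne: "frontier \<Omega> \<noteq> {}" by (rule frontier_nonempty_of_bounded_lipschitz_domain[OF dom])
  have frontier_compact: "compact (frontier \<Omega>)" by (rule compact_frontier_bounded[OF \<Omega>(2)])
  obtain k where k: "0 \<le> k" "K_level \<Omega> \<omega> \<epsilon> = ennreal k"
    using fin by (cases "K_level \<Omega> \<omega> \<epsilon>") auto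
  obtain a where a: "0 < a" "\<And>n (S :: 'a set) W. norm n = 1 \<Longrightarrow> W \<subseteq> sweep n S \<Longrightarrow>
      ennreal a * emeasure lborel W \<le> hausdorff_outer (DIM('a) - 1) S"
    using emeasure_sweep_le_hausdorff_outer by blast
  obtain \<rho> n c where loc: "\<And>p. p \<in> frontier \<Omega> \<Longrightarrow> 0 < \<rho> p \<and> 0 < c p \<and> norm (n p) = 1 \<and>
      (\<forall>x s. x \<in> \<Omega> \<inter> ball p (\<rho> p) \<longrightarrow> 0 \<le> s \<longrightarrow> x + s *\<^sub>R n p \<in> ball p (\<rho> p) \<longrightarrow>
        ?\<delta> x + c p * s \<le> ?\<delta> (x + s *\<^sub>R n p))"
    using boundary_dist_increasing_locally[OF \<Omega>(1,3)] by metis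
  obtain P where P: "P \<subseteq> frontier \<Omega>" "finite P" "frontier \<Omega> \<subseteq> (\<Union>p\<in>P. ball p (\<rho> p))"
  proof (rule compactE_image[OF frontier_compact])
    show "frontier \<Omega> \<subseteq> (\<Union>p\<in>frontier \<Omega>. ball p (\<rho> p))" using loc by fastforce
  qed auto
  obtain e where e: "0 < e" "(\<Union>q\<in>frontier \<Omega>. cball q e) \<subseteq> (\<Union>p\<in>P. ball p (\<rho> p))"
    by (rule compact_subset_open_imp_cball_epsilon_subset[OF frontier_compact _ P(3)]) auto
  have cover: "{x \<in> \<Omega>. ?\<delta> x < r} \<subseteq> (\<Union>p\<in>P. {x \<in> \<Omega> \<inter> ball p (\<rho> p). ?\<delta> x < r})" if "r \<le> e" for r
  proof
    fix x assume x: "x \<in> {x \<in> \<Omega>. ?\<delta> x < r}"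
    obtain q where "q \<in> frontier \<Omega>" "?\<delta> x = dist x q"
      using infdist_attains_inf[OF frontier_closed ne, of x] by (auto simp: boundary_dist_def)
    then have "x \<in> (\<Union>q\<in>frontier \<Omega>. cball q e)"
      using x that by (auto simp: dist_commute intro!: bexI[of _ q])
    then show "x \<in> (\<Union>p\<in>P. {x \<in> \<Omega> \<inter> ball p (\<rho> p). ?\<delta> x < r})" using e(2) x by blast
  qed
  have AE_level: "AE t in lebesgue_on {0..\<epsilon>}.
      (\<integral>\<^sup>+x\<in>boundary_level \<Omega> t. ennreal (\<omega> x) \<partial>hausdorff_measure (DIM('a) - 1)) \<le> ennreal k"
    using esssup_AE[of _ "lebesgue_on {0..\<epsilon>}"] unfolding k(2)[symmetric] K_level_def .
  have patch: "emeasure ?M {x \<in> \<Omega> \<inter> ball p (\<rho> p). ?\<delta> x < r} \<le> ennreal (k / (a * c p) * r)"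
    and patch_sets: "{x \<in> \<Omega> \<inter> ball p (\<rho> p). ?\<delta> x < r} \<in> sets ?M"
    if p: "p \<in> P" and r: "0 < r" "r \<le> \<epsilon>" for p r
  proof -
    define V where "V = {x \<in> \<Omega> \<inter> ball p (\<rho> p). ?\<delta> x < r}"
    have p': "p \<in> frontier \<Omega>" using p P(1) by blast
    have cp: "0 < c p" and np: "norm (n p) = 1" using loc[OF p'] by auto
    have "open (\<Omega> \<inter> ball p (\<rho> p) \<inter> {x. ?\<delta> x < r})"
      by (intro open_Int \<Omega>(1) open_ball open_Collect_less continuous_on_boundary_dist continuous_on_const)
    moreover have "V = \<Omega> \<inter> ball p (\<rho> p) \<inter> {x. ?\<delta> x < r}" by (auto simp: V_def)
    ultimately have V_open: "open V" by simp
    then have V_leb: "V \<in> sets lebesgue" by simp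
    have V_sub: "V \<subseteq> \<Omega>" by (auto simp: V_def)
    then have V_sets: "V \<in> sets (lebesgue_on \<Omega>)" using V_leb \<Omega>(1) by (simp add: sets_restrict_space_iff)
    then show "{x \<in> \<Omega> \<inter> ball p (\<rho> p). ?\<delta> x < r} \<in> sets ?M" by (simp add: V_def)
    have "ennreal (a * c p) * (\<integral>\<^sup>+x. ennreal (\<omega> x) \<partial>lebesgue_on V) \<le> ennreal k * ennreal r"
    proof (rule nn_integral_le_of_slices_le[where \<delta> = ?\<delta> and n = "n p"])
      show "\<omega> \<in> borel_measurable (lebesgue_on V)"
        using meas V_sub \<Omega>(1) V_leb by (intro measurable_restrict_mono[OF meas V_sub])
      show "bounded V" by (rule bounded_subset[OF \<Omega>(2) V_sub])
      show "?\<delta> x \<in> {0..r}" if "x \<in> V" for x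
        using that by (auto simp: V_def boundary_dist_def infdist_nonneg)
      show "?\<delta> x + c p * s \<le> ?\<delta> (x + s *\<^sub>R n p)" if "x \<in> V" "0 \<le> s" "x + s *\<^sub>R n p \<in> V" for x s
        using loc[OF p'] that by (auto simp: V_def)
      have "AE t in lebesgue. t \<in> {0..\<epsilon>} \<longrightarrow>
          (\<integral>\<^sup>+x\<in>boundary_level \<Omega> t. ennreal (\<omega> x) \<partial>hausdorff_measure (DIM('a) - 1)) \<le> ennreal k"
        using AE_level by (simp add: AE_restrict_space_iff)
      then have "AE t in lebesgue. t \<in> {0..r} \<longrightarrow>
          (\<integral>\<^sup>+x\<in>{x \<in> V. ?\<delta> x = t}. ennreal (\<omega> x) \<partial>hausdorff_measure (DIM('a) - 1)) \<le> ennreal k"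
      proof eventually_elim
        case (elim t)
        show ?case
        proof
          assume "t \<in> {0..r}"
          have "{x \<in> V. ?\<delta> x = t} \<subseteq> boundary_level \<Omega> t"
            using V_sub closure_subset[of \<Omega>] by (auto simp: boundary_level_def)
          then have "(\<integral>\<^sup>+x\<in>{x \<in> V. ?\<delta> x = t}. ennreal (\<omega> x) \<partial>hausdorff_measure (DIM('a) - 1))
              \<le> (\<integral>\<^sup>+x\<in>boundary_level \<Omega> t. ennreal (\<omega> x) \<partial>hausdorff_measure (DIM('a) - 1))"
            by (intro nn_integral_mono mult_left_mono) (auto simp: indicator_def)
          also have "\<dots> \<le> ennreal k" using elim \<open>t \<in> {0..r}\<close> r by auto
          finally show "(\<integral>\<^sup>+x\<in>{x \<in> V. ?\<delta> x = t}. ennreal (\<omega> x) \<partial>hausdorff_measure (DIM('a) - 1)) \<le> ennreal k" .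
        qed
      qed
      then show "AE t in lebesgue_on {0..r}.
          (\<integral>\<^sup>+x\<in>{x \<in> V. ?\<delta> x = t}. ennreal (\<omega> x) \<partial>hausdorff_measure (DIM('a) - 1)) \<le> ennreal k"
        by (simp add: AE_restrict_space_iff)
    qed (use a np cp r V_leb continuous_on_boundary_dist in auto)
    then have "ennreal (1 / (a * c p)) * (ennreal (a * c p) * (\<integral>\<^sup>+x. ennreal (\<omega> x) \<partial>lebesgue_on V))
        \<le> ennreal (1 / (a * c p)) * (ennreal k * ennreal r)"
      by (rule mult_left_mono) simp
    also have "\<dots> = ennreal (k / (a * c p) * r)"
      using a(1) cp k(1) r by (simp flip: ennreal_mult)
    also have "ennreal (1 / (a * c p)) * (ennreal (a * c p) * (\<integral>\<^sup>+x. ennreal (\<omega> x) \<partial>lebesgue_on V))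
        = (ennreal (1 / (a * c p)) * ennreal (a * c p)) * (\<integral>\<^sup>+x. ennreal (\<omega> x) \<partial>lebesgue_on V)"
      by (simp only: mult.assoc)
    also have "ennreal (1 / (a * c p)) * ennreal (a * c p) = 1"
      using a(1) cp by (simp flip: ennreal_mult)
    also have "1 * (\<integral>\<^sup>+x. ennreal (\<omega> x) \<partial>lebesgue_on V) = (\<integral>\<^sup>+x\<in>V. ennreal (\<omega> x) \<partial>lebesgue)"
      using V_leb by (simp add: nn_integral_restrict_space)
    also have "\<dots> = (\<integral>\<^sup>+x\<in>V. ennreal (\<omega> x) \<partial>lebesgue_on \<Omega>)"
      using \<Omega>(1) V_sub by (subst nn_integral_restrict_space) (auto intro!: nn_integral_cong simp: indicator_def)
    also have "\<dots> = emeasure ?M V"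
      using meas V_sets by (simp add: emeasure_density)
    finally show "emeasure ?M {x \<in> \<Omega> \<inter> ball p (\<rho> p). ?\<delta> x < r} \<le> ennreal (k / (a * c p) * r)"
      by (simp add: V_def)
  qed
  define C where "C = (\<Sum>p\<in>P. k / (a * c p))"
  have c_pos: "0 < c p" if "p \<in> P" for p using that loc P(1) by blast
  have "emeasure ?M {x \<in> \<Omega>. ?\<delta> x < r} \<le> ennreal (C * r)" if r: "0 < r" "r \<le> min e \<epsilon>" for r
  proof -
    have "emeasure ?M {x \<in> \<Omega>. ?\<delta> x < r} \<le> emeasure ?M (\<Union>p\<in>P. {x \<in> \<Omega> \<inter> ball p (\<rho> p). ?\<delta> x < r})"
      using cover[of r] r patch_sets[of _ r] P(2) by (intro emeasure_mono sets.finite_UN) auto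
    also have "\<dots> \<le> (\<Sum>p\<in>P. emeasure ?M {x \<in> \<Omega> \<inter> ball p (\<rho> p). ?\<delta> x < r})"
      using patch_sets[of _ r] r P(2) by (intro emeasure_subadditive_finite) auto
    also have "\<dots> \<le> (\<Sum>p\<in>P. ennreal (k / (a * c p) * r))"
      using r by (intro sum_mono patch) auto
    also have "\<dots> = ennreal (C * r)"
      using a(1) c_pos k(1) r
      by (subst sum_ennreal) (auto simp: C_def sum_distrib_right intro!: mult_nonneg_nonneg divide_nonneg_nonneg less_imp_le[OF c_pos])
    finally show ?thesis .
  qed
  moreover have "0 \<le> C"
    using a(1) k(1) c_pos unfolding C_def by (intro sum_nonneg divide_nonneg_nonneg mult_nonneg_nonneg) (auto intro: less_imp_le)
  ultimately show ?thesis using e(1) eps by (intro exI[of _ C] exI[of _ "min e \<epsilon>"]) auto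
qed

section \<open>Continuous profiles and the main result\<close>

lemma boundary_layer_mass_tendsto_zero:
  fixes \<Omega> :: "'a::euclidean_space set"
  assumes \<Omega>: "open \<Omega>" "frontier \<Omega> \<noteq> {}" and M: "space M = \<Omega>" "boundary_dist \<Omega> \<in> borel_measurable M"
    and fin: "emeasure M \<Omega> \<noteq> \<infinity>" and e: "0 < e"
  shows "\<exists>t>0. emeasure M {x \<in> \<Omega>. boundary_dist \<Omega> x < t} < ennreal e"
proof -
  define E where "E m = {x \<in> space M. boundary_dist \<Omega> x < 1 / Suc m}" for m
  have E_sets: "E m \<in> sets M" for m using M(2) unfolding E_def by measurable
  have "(\<lambda>m. emeasure M (E m)) \<longlonglongrightarrow> emeasure M (\<Inter>m. E m)"
  proof (rule Lim_emeasure_decseq)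
    show "range E \<subseteq> sets M" using E_sets by auto
    show "decseq E"
    proof (intro decseq_SucI subsetI)
      fix m x assume "x \<in> E (Suc m)"
      moreover have "1 / real (Suc (Suc m)) \<le> 1 / real (Suc m)" by (intro frac_le) auto
      ultimately show "x \<in> E m" by (auto simp: E_def)
    qed
    show "emeasure M (E i) \<noteq> \<infinity>" for i
      using emeasure_space[of M "E i"] fin M(1) by (auto simp: top_unique)
  qed
  moreover have "(\<Inter>m. E m) = {}"
  proof (rule ccontr)
    assume "(\<Inter>m. E m) \<noteq> {}"
    then obtain x where x: "\<And>m. x \<in> E m" by blast
    then have "0 < boundary_dist \<Omega> x"
      using boundary_dist_pos[OF \<Omega>, of x] M(1) by (auto simp: E_def)
    then obtain m where "1 / real (Suc m) < boundary_dist \<Omega> x"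
      using nat_approx_posE by (metis of_nat_Suc)
    then show False using x[of m] by (auto simp: E_def)
  qed
  ultimately have "(\<lambda>m. emeasure M (E m)) \<longlonglongrightarrow> 0" by simp
  then have "\<forall>\<^sub>F m in sequentially. emeasure M (E m) < ennreal e"
    using e by (intro order_tendstoD(2)) auto
  then obtain m where "emeasure M (E m) < ennreal e" by (auto simp: eventually_sequentially)
  then show ?thesis
    using M(1) by (intro exI[of _ "1 / real (Suc m)"]) (simp add: E_def)
qed

text \<open>The series \<open>\<Sum>\<^sub>k 2\<^sup>-\<^sup>k min 1 (t / T k)\<close> converges uniformly, and its \<open>k\<close>-th term alone is
  already \<open>2\<^sup>-\<^sup>k\<close> for \<open>t \<ge> T k\<close>.\<close>

lemma exists_profile_above_dyadic:
  fixes T :: "nat \<Rightarrow> real"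
  assumes T: "\<And>k. 0 < T k"
  obtains h :: "real \<Rightarrow> real" where "continuous_on {0..} h" "h 0 = 0"
    "\<And>t. 0 \<le> t \<Longrightarrow> 0 \<le> h t \<and> h t \<le> 2" "\<And>t k. T k \<le> t \<Longrightarrow> (1 / 2) ^ k \<le> h t"
proof
  define g where "g k t = (1 / 2) ^ k * min 1 (t / T k)" for k t
  define h where "h t = (\<Sum>k. g k t)" for t
  have g: "0 \<le> g k t" "g k t \<le> (1 / 2) ^ k" if "0 \<le> t" for k t
    using that T[of k] by (auto simp: g_def intro!: mult_left_le)
  have geo: "summable (\<lambda>k. (1 / 2 :: real) ^ k)" by (simp add: summable_geometric)
  have summ: "summable (\<lambda>k. g k t)" if "0 \<le> t" for t
    using g[OF that] by (intro summable_comparison_test'[OF geo, of 0]) auto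
  show "continuous_on {0..} h"
  proof (rule uniform_limit_theorem)
    show "uniform_limit {0..} (\<lambda>n t. \<Sum>k<n. g k t) h sequentially"
      unfolding h_def using g by (intro Weierstrass_m_test[OF _ geo]) auto
    show "\<forall>\<^sub>F n in sequentially. continuous_on {0..} (\<lambda>t. \<Sum>k<n. g k t)"
      unfolding g_def using T by (intro always_eventually allI continuous_intros) (auto simp: less_imp_neq[symmetric])
  qed simp
  show "h 0 = 0" by (simp add: h_def g_def)
  show "0 \<le> h t \<and> h t \<le> 2" if "0 \<le> t" for t
  proof
    show "0 \<le> h t" unfolding h_def using g[OF that] by (intro suminf_nonneg summ that) auto
    have "h t \<le> (\<Sum>k. (1 / 2) ^ k)" unfolding h_def using g[OF that] by (intro suminf_le summ that geo)
    then show "h t \<le> 2" by (simp add: suminf_geometric)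
  qed
  show "(1 / 2) ^ k \<le> h t" if "T k \<le> t" for k t
  proof -
    have t: "0 \<le> t" using T[of k] that by linarith
    have "(1 / 2) ^ k = (\<Sum>j\<in>{k}. g j t)" using T[of k] that by (simp add: g_def)
    also have "\<dots> \<le> h t" unfolding h_def using g[OF t] by (intro sum_le_suminf summ t) auto
    finally show ?thesis .
  qed
qed

theorem proposition1:
  fixes \<Omega> :: "'a::euclidean_space set" and \<omega> :: "'a \<Rightarrow> real"
  assumes "bounded_lipschitz_domain \<Omega>"
    and "integrable (lebesgue_on \<Omega>) \<omega>"
    and "(LINT x|lebesgue_on \<Omega>. \<omega> x) = 1"
    and "AE x in lebesgue_on \<Omega>. \<omega> x \<ge> 0"
  shows "(\<exists>\<xi> :: 'a \<Rightarrow> real. continuous_on (closure \<Omega>) \<xi> \<and> (\<forall>x\<in>closure \<Omega>. \<xi> x \<ge> 0) \<and>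
            (\<forall>x\<in>frontier \<Omega>. \<xi> x = 0) \<and> log_integral \<Omega> \<omega> \<xi> = 0)
       \<and> ((\<exists>\<epsilon>>0. K_level \<Omega> \<omega> \<epsilon> < \<infinity>) \<longrightarrow>
            (\<exists>\<xi> \<in> lipschitz_zero \<Omega>. (\<forall>x\<in>closure \<Omega>. \<xi> x \<ge> 0) \<and> log_integral \<Omega> \<omega> \<xi> = 0))"
proof -
  define M where "M = density (lebesgue_on \<Omega>) (\<lambda>x. ennreal (\<omega> x))"
  let ?\<delta> = "boundary_dist \<Omega>"
  have \<Omega>: "open \<Omega>" "bounded \<Omega>" using assms(1) by (auto simp: bounded_lipschitz_domain_def)
  have ne: "frontier \<Omega> \<noteq> {}" by (rule frontier_nonempty_of_bounded_lipschitz_domain[OF assms(1)])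
  have meas: "\<omega> \<in> borel_measurable (lebesgue_on \<Omega>)" using assms(2) by auto
  have space_M: "space M = \<Omega>" by (simp add: M_def space_restrict_space)
  have total: "emeasure M \<Omega> = 1"
  proof -
    have "emeasure M (space M) = (\<integral>\<^sup>+x. ennreal (\<omega> x) \<partial>lebesgue_on \<Omega>)"
      unfolding M_def space_density using meas
      by (subst emeasure_density) (auto intro!: nn_integral_cong simp del: space_restrict_space)
    also have "\<dots> = 1" using nn_integral_eq_integral[OF assms(2,4)] assms(3) by simp
    finally show ?thesis by (simp add: space_M)
  qed
  have meas_M: "\<psi> \<in> borel_measurable M" if "continuous_on (closure \<Omega>) \<psi>" for \<psi> :: "'a \<Rightarrow> real"
  proof -
    have "continuous_on \<Omega> \<psi>" using that closure_subset continuous_on_subset by blast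
    then show ?thesis
      using \<Omega>(1) by (simp add: M_def continuous_imp_measurable_on_sets_lebesgue)
  qed
  have scaling: "\<exists>c>0. log_integral \<Omega> \<omega> (\<lambda>x. c * \<psi> x) = 0"
    if cont: "continuous_on (closure \<Omega>) \<psi>" and nonneg: "\<And>x. x \<in> closure \<Omega> \<Longrightarrow> 0 \<le> \<psi> x"
      and small: "\<And>k. emeasure M {x \<in> \<Omega>. \<psi> x < (1 / 2) ^ k} \<le> ennreal (C * (1 / 2) ^ k)"
    for \<psi> :: "'a \<Rightarrow> real" and C
  proof -
    have "compact (\<psi> ` closure \<Omega>)" using \<Omega>(2) cont by (intro compact_continuous_image) auto
    then obtain b where b: "\<And>x. x \<in> closure \<Omega> \<Longrightarrow> \<bar>\<psi> x\<bar> \<le> b"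
      using compact_imp_bounded bounded_iff by (metis (no_types, lifting) image_eqI real_norm_def)
    have cl: "x \<in> closure \<Omega>" if "x \<in> \<Omega>" for x using that closure_subset by blast
    show ?thesis
      unfolding log_integral_def M_def[symmetric]
    proof (rule exists_scaling_log_integral_zero)
      show "\<psi> x \<le> b" if "x \<in> space M" for x using b[OF cl, of x] that by (simp add: space_M)
      show "0 \<le> \<psi> x" if "x \<in> space M" for x using nonneg[OF cl, of x] that by (simp add: space_M)
    qed (use total small meas_M[OF cont] in \<open>simp_all add: space_M\<close>)
  qed
  have \<delta>_nonneg: "0 \<le> ?\<delta> x" for x by (simp add: boundary_dist_def infdist_nonneg)
  have \<delta>_frontier: "?\<delta> x = 0" if "x \<in> frontier \<Omega>" for x using that by (simp add: boundary_dist_def)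
  show ?thesis
  proof (intro conjI impI)
    have "\<exists>t>0. emeasure M {x \<in> \<Omega>. ?\<delta> x < t} < ennreal ((1 / 2) ^ k)" for k
      by (rule boundary_layer_mass_tendsto_zero[OF \<Omega>(1) ne space_M meas_M[OF continuous_on_boundary_dist]])
        (simp_all add: total)
    then obtain T where T: "\<And>k. 0 < T k" "\<And>k. emeasure M {x \<in> \<Omega>. ?\<delta> x < T k} < ennreal ((1 / 2) ^ k)"
      by metis
    obtain h :: "real \<Rightarrow> real" where h: "continuous_on {0..} h" "h 0 = 0"
        "\<And>t. 0 \<le> t \<Longrightarrow> 0 \<le> h t \<and> h t \<le> 2" "\<And>t k. T k \<le> t \<Longrightarrow> (1 / 2) ^ k \<le> h t"
      using exists_profile_above_dyadic[of T] T(1) by blast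
    define \<psi> where "\<psi> x = h (?\<delta> x)" for x
    have cont: "continuous_on (closure \<Omega>) \<psi>"
      unfolding \<psi>_def using \<delta>_nonneg
      by (intro continuous_on_compose2[OF h(1) continuous_on_boundary_dist]) auto
    have nonneg: "0 \<le> \<psi> x" for x using h(3) \<delta>_nonneg by (simp add: \<psi>_def)
    have "emeasure M {x \<in> \<Omega>. \<psi> x < (1 / 2) ^ k} \<le> ennreal (1 * (1 / 2) ^ k)" for k
    proof -
      have "{x \<in> \<Omega>. ?\<delta> x < T k} = {x \<in> space M. ?\<delta> x < T k}" by (simp add: space_M)
      also have "\<dots> \<in> sets M"
        using meas_M[OF continuous_on_boundary_dist] by measurable
      finally have "emeasure M {x \<in> \<Omega>. \<psi> x < (1 / 2) ^ k} \<le> emeasure M {x \<in> \<Omega>. ?\<delta> x < T k}"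
        using h(4) by (intro emeasure_mono) (auto simp: \<psi>_def not_less[symmetric])
      also have "\<dots> \<le> ennreal (1 * (1 / 2) ^ k)" using T(2)[of k] by simp
      finally show ?thesis .
    qed
    then obtain c where c: "0 < c" "log_integral \<Omega> \<omega> (\<lambda>x. c * \<psi> x) = 0"
      using scaling[OF cont nonneg] by blast
    show "\<exists>\<xi> :: 'a \<Rightarrow> real. continuous_on (closure \<Omega>) \<xi> \<and> (\<forall>x\<in>closure \<Omega>. \<xi> x \<ge> 0) \<and>
        (\<forall>x\<in>frontier \<Omega>. \<xi> x = 0) \<and> log_integral \<Omega> \<omega> \<xi> = 0"
      using c nonneg cont \<delta>_frontier h(2)
      by (intro exI[of _ "\<lambda>x. c * \<psi> x"]) (auto simp: \<psi>_def intro!: continuous_intros)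
  next
    assume "\<exists>\<epsilon>>0. K_level \<Omega> \<omega> \<epsilon> < \<infinity>"
    then obtain \<epsilon> where \<epsilon>: "0 < \<epsilon>" "K_level \<Omega> \<omega> \<epsilon> < \<infinity>" by blast
    obtain C r where C: "0 \<le> C" and r: "0 < r"
      and layer: "\<And>t. 0 < t \<Longrightarrow> t \<le> r \<Longrightarrow> emeasure M {x \<in> \<Omega>. ?\<delta> x < t} \<le> ennreal (C * t)"
      using boundary_layer_mass_le[OF assms(1) meas \<epsilon>] unfolding M_def[symmetric] by blast
    \<comment> \<open>The summand \<open>1 / r\<close> covers the levels above \<open>r\<close>, where only the total mass \<open>1\<close> is a bound.\<close>
    have "emeasure M {x \<in> \<Omega>. ?\<delta> x < (1 / 2) ^ k} \<le> ennreal ((C + 1 / r) * (1 / 2) ^ k)" for k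
    proof (cases "(1 / 2) ^ k \<le> r")
      case True
      then have "emeasure M {x \<in> \<Omega>. ?\<delta> x < (1 / 2) ^ k} \<le> ennreal (C * (1 / 2) ^ k)"
        by (intro layer) auto
      also have "\<dots> \<le> ennreal ((C + 1 / r) * (1 / 2) ^ k)"
        using r by (intro ennreal_leI mult_right_mono) auto
      finally show ?thesis .
    next
      case False
      have "emeasure M {x \<in> \<Omega>. ?\<delta> x < (1 / 2) ^ k} \<le> ennreal 1"
        using emeasure_space[of M] total by (simp add: space_M)
      also have "1 \<le> (1 / r) * (1 / 2) ^ k" using False r by (simp add: field_simps)
      also have "\<dots> \<le> (C + 1 / r) * (1 / 2) ^ k" using C by (intro mult_right_mono) auto
      finally show ?thesis by (simp add: ennreal_leI)
    qed
    then obtain c where c: "0 < c" "log_integral \<Omega> \<omega> (\<lambda>x. c * ?\<delta> x) = 0"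
      using scaling[OF continuous_on_boundary_dist \<delta>_nonneg] by blast
    have "c-lipschitz_on (closure \<Omega>) (\<lambda>x. c * ?\<delta> x)"
    proof (rule lipschitz_onI)
      fix x y
      have "\<bar>?\<delta> x - ?\<delta> y\<bar> \<le> dist x y"
        using infdist_triangle_abs[of x "frontier \<Omega>" y] by (simp add: boundary_dist_def)
      then show "dist (c * ?\<delta> x) (c * ?\<delta> y) \<le> c * dist x y"
        using c(1) by (simp add: dist_real_def abs_mult flip: right_diff_distrib)
    qed (use c(1) in simp)
    then have "(\<lambda>x. c * ?\<delta> x) \<in> lipschitz_zero \<Omega>"
      using \<delta>_frontier by (auto simp: lipschitz_zero_def)
    then show "\<exists>\<xi> \<in> lipschitz_zero \<Omega>. (\<forall>x\<in>closure \<Omega>. \<xi> x \<ge> 0) \<and> log_integral \<Omega> \<omega> \<xi> = 0"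
      using c \<delta>_nonneg by (intro bexI[of _ "\<lambda>x. c * ?\<delta> x"]) auto
  qed
qed

end
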